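(* Let $1/2 \leq \epsilon \leq 1$. There is a MapReduce algorithm that solves \textsf{3-SUM} on inputs of size $n$ using $O(n^{2(1-\epsilon)})$ machines, each with memory $O(n^{\epsilon})$, in two MapReduce rounds. The overall running time of the algorithm (summed over all machines) is $O(n^2)$.
   Context: \textsf{3-SUM}: given three lists $A=\{a_1,\dots,a_n\}$, $B=\{b_1,\dots,b_n\}$, $C=\{c_1,\dots,c_n\}$ of integers, decide whether there exist $a\in A$, $b\in B$, $c\in C$ with $a+b=c$. Standing assumption of the paper: each list contains exactly $n$ numbers and is given sorted, i.e. $a_i<a_j$, $b_i<b_j$, $c_i<c_j$ for all $i<j$. MapReduce model: the computation proceeds in synchronous rounds; in each round every machine performs arbitrary local computation on the data in its local memory and then machines exchange data (a machine can send/receive at most as much data as its memory); the input is initially distributed among the machines. "Memory" is the number of words (numbers) a single machine can store, and the overall running time is the sum of local computation times over all machines and rounds. *)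

theory Defs
  imports Complex_Main "HOL-Library.Landau_Symbols"
begin

section \<open>The problem\<close>

definition three_sum_input :: "nat \<Rightarrow> int list \<Rightarrow> int list \<Rightarrow> int list \<Rightarrow> bool" where
  "three_sum_input n A B C \<longleftrightarrow>
     length A = n \<and> length B = n \<and> length C = n \<and>
     sorted_wrt (<) A \<and> sorted_wrt (<) B \<and> sorted_wrt (<) C"

definition three_sum :: "int list \<Rightarrow> int list \<Rightarrow> int list \<Rightarrow> bool" where
  "three_sum A B C \<longleftrightarrow> (\<exists>a\<in>set A. \<exists>b\<in>set B. \<exists>c\<in>set C. a + b = c)"


section \<open>Local computation: a word RAM\<close>

text \<open>
  A machine runs a structured program over finitely many registers (those that occur in the
  program text) and an addressable local memory.  An expression costs its number of nodes.
\<close>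

datatype expr =
    Lit int
  | Reg nat
  | Load expr
  | Plus expr expr
  | Minus expr expr
  | Times expr expr
  | Div expr expr
  | Mod expr expr
  | Less expr expr
  | Equal expr expr

datatype com =
    Skip
  | Assign nat expr
  | Store expr expr          \<comment> \<open>address, value\<close>
  | Send expr "expr list"    \<comment> \<open>destination machine, payload\<close>
  | Seq com com
  | If expr com com
  | While expr com

record state =
  regs :: "nat \<Rightarrow> int"
  mem :: "int \<Rightarrow> int"
  sent :: "(int \<times> int list) list"    \<comment> \<open>messages (destination, payload), oldest first\<close>

primrec eval :: "expr \<Rightarrow> state \<Rightarrow> int" where
  "eval (Lit k) \<sigma> = k"
| "eval (Reg r) \<sigma> = regs \<sigma> r"
| "eval (Load e) \<sigma> = mem \<sigma> (eval e \<sigma>)"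
| "eval (Plus e f) \<sigma> = eval e \<sigma> + eval f \<sigma>"
| "eval (Minus e f) \<sigma> = eval e \<sigma> - eval f \<sigma>"
| "eval (Times e f) \<sigma> = eval e \<sigma> * eval f \<sigma>"
| "eval (Div e f) \<sigma> = eval e \<sigma> div eval f \<sigma>"
| "eval (Mod e f) \<sigma> = eval e \<sigma> mod eval f \<sigma>"
| "eval (Less e f) \<sigma> = (if eval e \<sigma> < eval f \<sigma> then 1 else 0)"
| "eval (Equal e f) \<sigma> = (if eval e \<sigma> = eval f \<sigma> then 1 else 0)"

primrec cost :: "expr \<Rightarrow> nat" where
  "cost (Lit k) = 1"
| "cost (Reg r) = 1"
| "cost (Load e) = 1 + cost e"
| "cost (Plus e f) = 1 + cost e + cost f"
| "cost (Minus e f) = 1 + cost e + cost f"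
| "cost (Times e f) = 1 + cost e + cost f"
| "cost (Div e f) = 1 + cost e + cost f"
| "cost (Mod e f) = 1 + cost e + cost f"
| "cost (Less e f) = 1 + cost e + cost f"
| "cost (Equal e f) = 1 + cost e + cost f"

text \<open>
  \<open>exec W S c \<sigma> t \<tau>\<close>: program \<open>c\<close> takes \<open>\<sigma>\<close> to \<open>\<tau>\<close> in \<open>t\<close> steps on a machine with \<open>S\<close> memory
  words, where a word holds an integer of absolute value at most \<open>W\<close>.  There is no derivation for
  a program that diverges, writes outside the memory, or stores or sends a value that does not fit
  in a word.  The bound \<open>W\<close> is what makes counting words meaningful: with unbounded words, many
  numbers could be packed into one.
\<close>

inductive exec :: "int \<Rightarrow> nat \<Rightarrow> com \<Rightarrow> state \<Rightarrow> nat \<Rightarrow> state \<Rightarrow> bool" for W :: int and S :: nat where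
  Skip: "exec W S Skip \<sigma> 1 \<sigma>"
| Assign: "\<bar>eval e \<sigma>\<bar> \<le> W \<Longrightarrow>
    exec W S (Assign r e) \<sigma> (1 + cost e) (\<sigma>\<lparr>regs := (regs \<sigma>)(r := eval e \<sigma>)\<rparr>)"
| Store: "0 \<le> eval a \<sigma> \<Longrightarrow> eval a \<sigma> < int S \<Longrightarrow> \<bar>eval e \<sigma>\<bar> \<le> W \<Longrightarrow>
    exec W S (Store a e) \<sigma> (1 + cost a + cost e)
      (\<sigma>\<lparr>mem := (mem \<sigma>)(eval a \<sigma> := eval e \<sigma>)\<rparr>)"
| Send: "\<forall>e\<in>set es. \<bar>eval e \<sigma>\<bar> \<le> W \<Longrightarrow>
    exec W S (Send d es) \<sigma> (1 + cost d + sum_list (map cost es))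
      (\<sigma>\<lparr>sent := sent \<sigma> @ [(eval d \<sigma>, map (\<lambda>e. eval e \<sigma>) es)]\<rparr>)"
| Seq: "exec W S c1 \<sigma>1 t1 \<sigma>2 \<Longrightarrow> exec W S c2 \<sigma>2 t2 \<sigma>3 \<Longrightarrow>
    exec W S (Seq c1 c2) \<sigma>1 (t1 + t2) \<sigma>3"
| IfTrue: "eval b \<sigma> \<noteq> 0 \<Longrightarrow> exec W S c1 \<sigma> t \<tau> \<Longrightarrow> exec W S (If b c1 c2) \<sigma> (1 + cost b + t) \<tau>"
| IfFalse: "eval b \<sigma> = 0 \<Longrightarrow> exec W S c2 \<sigma> t \<tau> \<Longrightarrow> exec W S (If b c1 c2) \<sigma> (1 + cost b + t) \<tau>"
| WhileFalse: "eval b \<sigma> = 0 \<Longrightarrow> exec W S (While b c) \<sigma> (1 + cost b) \<sigma>"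
| WhileTrue: "eval b \<sigma>1 \<noteq> 0 \<Longrightarrow> exec W S c \<sigma>1 t1 \<sigma>2 \<Longrightarrow> exec W S (While b c) \<sigma>2 t2 \<sigma>3 \<Longrightarrow>
    exec W S (While b c) \<sigma>1 (1 + cost b + t1 + t2) \<sigma>3"


section \<open>MapReduce computations\<close>

text \<open>
  The same programs run on every machine and for every input size.  At the start of each local
  computation, registers 0 to 4 of machine \<open>m\<close> hold the input size \<open>n\<close>, the number \<open>M\<close> of
  machines, the memory size \<open>S\<close>, the machine's own number \<open>m\<close> and the number of words in its inbox;
  the inbox fills the memory from address 0, and everything else is 0.  No other local data
  survives an exchange: what a machine wants to keep it has to send to itself.
\<close>

definition start :: "nat \<Rightarrow> nat \<Rightarrow> nat \<Rightarrow> nat \<Rightarrow> int list \<Rightarrow> state" where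
  "start n M S m ws =
     \<lparr>regs = (\<lambda>_. 0)(0 := int n, 1 := int M, 2 := int S, 3 := int m, 4 := int (length ws)),
      mem = (\<lambda>a. if 0 \<le> a \<and> a < int (length ws) then ws ! nat a else 0),
      sent = []\<rparr>"

definition local_phase ::
  "int \<Rightarrow> nat \<Rightarrow> nat \<Rightarrow> nat \<Rightarrow> com \<Rightarrow> (nat \<Rightarrow> int list) \<Rightarrow> (nat \<Rightarrow> nat) \<Rightarrow> (nat \<Rightarrow> state) \<Rightarrow> bool" where
  "local_phase W n M S c inbox t \<tau> \<longleftrightarrow>
     (\<forall>m<M. length (inbox m) \<le> S \<and> exec W S c (start n M S m (inbox m)) (t m) (\<tau> m))"

text \<open>Every recipient of a message is paid for separately, and the address counts as a word.\<close>

definition legal_outbox :: "nat \<Rightarrow> nat \<Rightarrow> (int \<times> int list) list \<Rightarrow> bool" where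
  "legal_outbox M S msgs \<longleftrightarrow>
     (\<forall>(d, ws)\<in>set msgs. 0 \<le> d \<and> d < int M) \<and>
     (\<Sum>(d, ws)\<leftarrow>msgs. 1 + length ws) \<le> S"

definition deliver :: "nat \<Rightarrow> (nat \<Rightarrow> (int \<times> int list) list) \<Rightarrow> nat \<Rightarrow> int list" where
  "deliver M outbox m =
     concat (map (\<lambda>k. concat (map snd (filter (\<lambda>(d, ws). d = int m) (outbox k)))) [0..<M])"

text \<open>
  \<open>mr_run W n M S cs fin inbox t ans\<close>: each program in \<open>cs\<close> is one round (local computation, then
  exchange).  After the last exchange the local computation \<open>fin\<close>, the final reduce step, produces
  the output: machine \<open>m\<close> reports success by leaving a nonzero value in register 5, and the answer
  is yes iff some machine reports success.  \<open>t\<close> adds up the steps of all machines in all phases.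
\<close>

inductive mr_run ::
  "int \<Rightarrow> nat \<Rightarrow> nat \<Rightarrow> nat \<Rightarrow> com list \<Rightarrow> com \<Rightarrow> (nat \<Rightarrow> int list) \<Rightarrow> nat \<Rightarrow> bool \<Rightarrow> bool"
  for W :: int and n M S :: nat where
  finish: "local_phase W n M S fin inbox t \<tau> \<Longrightarrow>
    mr_run W n M S [] fin inbox (\<Sum>m<M. t m) (\<exists>m<M. regs (\<tau> m) 5 \<noteq> 0)"
| round: "local_phase W n M S c inbox t \<tau> \<Longrightarrow> \<forall>m<M. legal_outbox M S (sent (\<tau> m)) \<Longrightarrow>
    mr_run W n M S cs fin (deliver M (\<lambda>m. sent (\<tau> m))) t' ans \<Longrightarrow>
    mr_run W n M S (c # cs) fin inbox ((\<Sum>m<M. t m) + t') ans"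


section \<open>Solving 3-SUM by MapReduce\<close>

text \<open>
  The \<open>3 * n\<close> input numbers are spread evenly over the machines in an arbitrary way: \<open>p l i\<close> is
  the machine that holds the \<open>i\<close>-th number of list \<open>l\<close> (\<open>0\<close>, \<open>1\<close>, \<open>2\<close> for \<open>A\<close>, \<open>B\<close>, \<open>C\<close>).  Each
  number comes with its key, i.e. its list and position.
\<close>

definition even_placement :: "nat \<Rightarrow> nat \<Rightarrow> (nat \<Rightarrow> nat \<Rightarrow> nat) \<Rightarrow> bool" where
  "even_placement n M p \<longleftrightarrow>
     (\<forall>l<3. \<forall>i<n. p l i < M) \<and>
     (\<forall>m<M. int (card {(l, i). l < 3 \<and> i < n \<and> p l i = m}) \<le> \<lceil>real (3 * n) / real M\<rceil>)"

lemma even_placement_exists: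
  assumes "0 < M"
  shows "even_placement n M (\<lambda>l i. (l * n + i) mod M)"
proof -
  have "int (card {(l, i). l < 3 \<and> i < n \<and> (l * n + i) mod M = m}) \<le> \<lceil>real (3 * n) / real M\<rceil>" for m
  proof -
    let ?X = "{(l, i). l < 3 \<and> i < n \<and> (l * n + i) mod M = m}"
    let ?f = "\<lambda>(l, i). (l * n + i) div M"
    let ?c = "nat \<lceil>real (3 * n) / real M\<rceil>"
    have "inj_on ?f ?X"
    proof (rule inj_onI, clarsimp)
      fix l i l' i'
      assume b: "i < n" "i' < n" and d: "(l * n + i) div M = (l' * n + i') div M"
        and m: "(l' * n + i') mod M = (l * n + i) mod M"
      have eq: "l * n + i = l' * n + i'" using d m by (metis div_mult_mod_eq)
      have "l = (l * n + i) div n" "l' = (l' * n + i') div n" using b by simp_all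
      with eq have "l = l'" by simp
      with eq show "l = l' \<and> i = i'" by simp
    qed
    moreover have "?f ` ?X \<subseteq> {..<?c}"
    proof
      fix k
      assume "k \<in> ?f ` ?X"
      then obtain l i where b: "l < 3" "i < n" and k: "k = (l * n + i) div M" by auto
      have "l * n \<le> 2 * n" using b(1) by (intro mult_le_mono1) simp
      then have "l * n + i < 3 * n" using b(2) by linarith
      moreover have "(l * n + i) div M * M \<le> l * n + i" by simp
      ultimately have "(l * n + i) div M * M < 3 * n" by linarith
      then have "real ((l * n + i) div M) * real M < real (3 * n)"
        by (simp only: of_nat_mult[symmetric] of_nat_less_iff)
      then have "real ((l * n + i) div M) < real (3 * n) / real M"
        using assms by (simp only: pos_less_divide_eq of_nat_0_less_iff)
      then have "int k < \<lceil>real (3 * n) / real M\<rceil>"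
        unfolding k less_ceiling_iff of_int_of_nat_eq .
      then show "k \<in> {..<?c}" unfolding lessThan_iff by linarith
    qed
    ultimately have "card ?X \<le> card {..<?c}" by (intro card_inj_on_le) auto
    then have "card ?X \<le> ?c" by simp
    moreover have "0 \<le> real (3 * n) / real M" by simp
    ultimately show ?thesis by linarith
  qed
  then show ?thesis using assms unfolding even_placement_def by simp
qed

definition initial_inbox ::
  "nat \<Rightarrow> int list \<Rightarrow> int list \<Rightarrow> int list \<Rightarrow> (nat \<Rightarrow> nat \<Rightarrow> nat) \<Rightarrow> nat \<Rightarrow> int list" where
  "initial_inbox n A B C p m =
     concat [[int l, int i, ([A, B, C] ! l) ! i]. l \<leftarrow> [0..<3], i \<leftarrow> [0..<n], p l i = m]"

text \<open>Words of \<open>O(log (n + u))\<close> bits, where \<open>u\<close> is the largest absolute value in the input.\<close>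

definition word_bound :: "nat \<Rightarrow> nat \<Rightarrow> int list \<Rightarrow> int list \<Rightarrow> int list \<Rightarrow> int" where
  "word_bound K n A B C =
     (int n + Max (insert 0 (abs ` (set A \<union> set B \<union> set C))) + 2) ^ K"

definition solves_three_sum ::
  "com list \<Rightarrow> com \<Rightarrow> (nat \<Rightarrow> nat) \<Rightarrow> (nat \<Rightarrow> nat) \<Rightarrow> (nat \<Rightarrow> nat) \<Rightarrow> bool" where
  "solves_three_sum cs fin M S T \<longleftrightarrow>
     (\<forall>n. 0 < M n) \<and>
     (\<exists>K. \<forall>n A B C p. three_sum_input n A B C \<longrightarrow> even_placement n (M n) p \<longrightarrow>
        (\<exists>t \<le> T n. mr_run (word_bound K n A B C) n (M n) (S n) cs fin
                     (initial_inbox n A B C p) t (three_sum A B C)))"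


section \<open>Runs are deterministic\<close>

text \<open>
  Hence the existential quantifier over runs in \<open>solves_three_sum\<close> speaks about the unique run.
\<close>

inductive_cases exec_elims:
  "exec W S Skip \<sigma> t \<tau>"
  "exec W S (Assign r e) \<sigma> t \<tau>"
  "exec W S (Store a e) \<sigma> t \<tau>"
  "exec W S (Send d es) \<sigma> t \<tau>"
  "exec W S (Seq c1 c2) \<sigma> t \<tau>"
  "exec W S (If b c1 c2) \<sigma> t \<tau>"
  "exec W S (While b c) \<sigma> t \<tau>"

lemma exec_deterministic:
  "exec W S c \<sigma> t \<tau> \<Longrightarrow> exec W S c \<sigma> t' \<tau>' \<Longrightarrow> t' = t \<and> \<tau>' = \<tau>"
proof (induction arbitrary: t' \<tau>' rule: exec.induct)
  case Seq
  from Seq.prems show ?case by (rule exec_elims(5)) (auto dest!: Seq.IH)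
next
  case IfTrue
  from IfTrue.prems show ?case by (rule exec_elims(6)) (auto simp: IfTrue.hyps dest!: IfTrue.IH)
next
  case IfFalse
  from IfFalse.prems show ?case by (rule exec_elims(6)) (auto simp: IfFalse.hyps dest!: IfFalse.IH)
next
  case WhileFalse
  from WhileFalse.prems show ?case by (rule exec_elims(7)) (auto simp: WhileFalse.hyps)
next
  case WhileTrue
  from WhileTrue.prems show ?case
    by (rule exec_elims(7)) (auto simp: WhileTrue.hyps dest!: WhileTrue.IH)
qed (auto elim: exec_elims(1-4))

lemma local_phase_deterministic:
  assumes "local_phase W n M S c inbox t \<tau>" "local_phase W n M S c inbox t' \<tau>'" "m < M"
  shows "t' m = t m \<and> \<tau>' m = \<tau> m"
  using assms exec_deterministic unfolding local_phase_def by blast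

lemma mr_run_deterministic:
  "mr_run W n M S cs fin inbox t ans \<Longrightarrow> mr_run W n M S cs fin inbox t' ans' \<Longrightarrow> t' = t \<and> ans' = ans"
proof (induction arbitrary: t' ans' rule: mr_run.induct)
  case (finish fin inbox t \<tau>)
  from finish.prems show ?case
  proof cases
    case (finish u \<rho>)
    have eq: "u m = t m \<and> \<rho> m = \<tau> m" if "m < M" for m
      using local_phase_deterministic[OF \<open>local_phase W n M S fin inbox t \<tau>\<close> finish(3) that] .
    then have "(\<Sum>m<M. u m) = (\<Sum>m<M. t m)" by simp
    with eq finish show ?thesis by auto
  qed
next
  case (round c inbox t \<tau> cs fin t2 ans)
  from round.prems show ?case
  proof cases
    case (round u \<rho> u2)
    have eq: "u m = t m \<and> \<rho> m = \<tau> m" if "m < M" for m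
      using local_phase_deterministic[OF \<open>local_phase W n M S c inbox t \<tau>\<close> round(2) that] .
    then have "(\<Sum>m<M. u m) = (\<Sum>m<M. t m)" by simp
    moreover have "deliver M (\<lambda>m. sent (\<rho> m)) = deliver M (\<lambda>m. sent (\<tau> m))"
    proof
      fix k
      have "map (\<lambda>j. concat (map snd (filter (\<lambda>(d, ws). d = int k) (sent (\<rho> j))))) [0..<M] =
            map (\<lambda>j. concat (map snd (filter (\<lambda>(d, ws). d = int k) (sent (\<tau> j))))) [0..<M]"
        using eq by (intro map_cong) auto
      then show "deliver M (\<lambda>m. sent (\<rho> m)) k = deliver M (\<lambda>m. sent (\<tau> m)) k"
        unfolding deliver_def by (rule arg_cong)
    qed
    ultimately show ?thesis using round round.IH by auto
  qed
qed

end

theory Submission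
  imports Defs
begin

text \<open>
  Cut every list into \<open>g \<approx> n\<^sup>1\<^sup>-\<^sup>\<epsilon>\<close> blocks of \<open>g * w \<approx> n\<^sup>\<epsilon>\<close> consecutive elements; \<open>g\<^sup>2\<close> machines are used.
  Fix a diagonal \<open>d\<close> of block pairs, \<open>i - j = d\<close>.  Along it the intervals containing the sums
  \<open>A\<^sub>i + B\<^sub>j\<close> are disjoint and increasing, and so are the blocks \<open>C\<^sub>k\<close>.  Hence the block triples
  that can contain a solution form a staircase, and the pair \<open>(d, i + k)\<close> determines such a triple:
  machine \<open>(d, i + k)\<close> can solve it by sorting and moving two pointers, in \<open>O((g * w)\<^sup>2)\<close> steps.

  No machine can learn all block boundaries in one round.  Instead the element at position \<open>p\<close> is
  first sent to all machines \<open>(p mod g, d)\<close>, so that machine \<open>(x, d)\<close> holds a sample of \<open>1 / g\<close> of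
  each list that meets every block.  The neighbouring sample points of a block approximate its
  boundaries well enough: the triples they do not exclude include all triples with a solution and
  are still at most a constant number per value of \<open>i + k\<close>.  In the second round machine \<open>(x, d)\<close>
  sends its part of each such triple to machine \<open>(d, i + k)\<close>.  Different samples may pass different
  spurious triples to the same machine, but these contain genuine elements only, so they cost space
  and do no harm.  Taking \<open>d\<close> and \<open>i + k\<close> modulo \<open>g\<close> loses a factor of 4.
\<close>

section \<open>Weakest preconditions with running time\<close>

text \<open>Total correctness: a derivation exists only for a run that terminates without a fault,
  and \<open>Q\<close> also sees the step count, so effect and running time are established
  together.\<close>

definition wp :: "int \<Rightarrow> nat \<Rightarrow> com \<Rightarrow> state \<Rightarrow> (nat \<Rightarrow> state \<Rightarrow> bool) \<Rightarrow> bool" where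
  "wp W S c \<sigma> Q \<longleftrightarrow> (\<exists>t \<tau>. exec W S c \<sigma> t \<tau> \<and> Q t \<tau>)"

lemma wp_Skip [simp]: "wp W S Skip \<sigma> Q \<longleftrightarrow> Q 1 \<sigma>"
  unfolding wp_def by (auto elim: exec_elims intro: exec.intros[simplified])

lemma wp_Assign [simp]:
  "wp W S (Assign r e) \<sigma> Q \<longleftrightarrow>
     \<bar>eval e \<sigma>\<bar> \<le> W \<and> Q (1 + cost e) (\<sigma>\<lparr>regs := (regs \<sigma>)(r := eval e \<sigma>)\<rparr>)"
  unfolding wp_def by (auto elim!: exec_elims(2) intro: exec.intros[simplified])

lemma wp_Store [simp]:
  "wp W S (Store a e) \<sigma> Q \<longleftrightarrow>
     0 \<le> eval a \<sigma> \<and> eval a \<sigma> < int S \<and> \<bar>eval e \<sigma>\<bar> \<le> W \<and>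
     Q (1 + cost a + cost e) (\<sigma>\<lparr>mem := (mem \<sigma>)(eval a \<sigma> := eval e \<sigma>)\<rparr>)"
  unfolding wp_def by (auto elim!: exec_elims(3) intro: exec.intros[simplified])

lemma wp_Send [simp]:
  "wp W S (Send d es) \<sigma> Q \<longleftrightarrow>
     (\<forall>e\<in>set es. \<bar>eval e \<sigma>\<bar> \<le> W) \<and>
     Q (1 + cost d + sum_list (map cost es))
       (\<sigma>\<lparr>sent := sent \<sigma> @ [(eval d \<sigma>, map (\<lambda>e. eval e \<sigma>) es)]\<rparr>)"
  unfolding wp_def by (auto elim!: exec_elims(4) intro: exec.intros[simplified])

lemma wp_Seq [simp]:
  "wp W S (Seq c1 c2) \<sigma> Q \<longleftrightarrow>
     wp W S c1 \<sigma> (\<lambda>t1 \<tau>. wp W S c2 \<tau> (\<lambda>t2 \<tau>'. Q (t1 + t2) \<tau>'))"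
  unfolding wp_def by (blast elim: exec_elims(5) intro: exec.intros[simplified])

lemma wp_If [simp]:
  "wp W S (If b c1 c2) \<sigma> Q \<longleftrightarrow>
     (if eval b \<sigma> \<noteq> 0 then wp W S c1 \<sigma> (\<lambda>t \<tau>. Q (1 + cost b + t) \<tau>)
      else wp W S c2 \<sigma> (\<lambda>t \<tau>. Q (1 + cost b + t) \<tau>))"
  unfolding wp_def by (auto elim!: exec_elims(6) intro: exec.intros[simplified])

lemma wp_mono: "wp W S c \<sigma> Q \<Longrightarrow> (\<And>t \<tau>. Q t \<tau> \<Longrightarrow> R t \<tau>) \<Longrightarrow> wp W S c \<sigma> R"
  unfolding wp_def by blast

lemma wp_While_False:
  "eval b \<sigma> = 0 \<Longrightarrow> Q (1 + cost b) \<sigma> \<Longrightarrow> wp W S (While b c) \<sigma> Q"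
  unfolding wp_def by (blast intro: exec.WhileFalse)

lemma wp_While_True:
  assumes "eval b \<sigma> \<noteq> 0"
    and "wp W S c \<sigma> (\<lambda>t1 \<tau>. wp W S (While b c) \<tau> (\<lambda>t2 \<tau>'. Q (1 + cost b + t1 + t2) \<tau>'))"
  shows "wp W S (While b c) \<sigma> Q"
  using assms unfolding wp_def by (blast intro: exec.WhileTrue)

text \<open>Each iteration lowers \<open>V\<close> and costs at most \<open>B\<close> plus the test,
  so there are at most \<open>V \<sigma>\<close> of them; the leading \<open>1 + cost b\<close> is
  the final, failing test. \<open>Q\<close> varies in the induction because it absorbs the time
  already spent.\<close>

lemma wp_While:
  assumes "I \<sigma>"
    and "\<And>\<tau>. I \<tau> \<Longrightarrow> eval b \<tau> \<noteq> 0 \<Longrightarrow> wp W S c \<tau> (\<lambda>t \<tau>'. t \<le> B \<and> I \<tau>' \<and> V \<tau>' < V \<tau>)"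
    and "\<And>t \<tau>. t \<le> 1 + cost b + V \<sigma> * (B + 1 + cost b) \<Longrightarrow> I \<tau> \<Longrightarrow> eval b \<tau> = 0 \<Longrightarrow> Q t \<tau>"
  shows "wp W S (While b c) \<sigma> Q"
  using assms(1,3)
proof (induction "V \<sigma>" arbitrary: \<sigma> Q rule: less_induct)
  case less
  show ?case
  proof (cases "eval b \<sigma> = 0")
    case True
    then show ?thesis using less.prems by (intro wp_While_False) auto
  next
    case False
    have "wp W S c \<sigma> (\<lambda>t1 \<tau>. wp W S (While b c) \<tau> (\<lambda>t2 \<tau>'. Q (1 + cost b + t1 + t2) \<tau>'))"
    proof (rule wp_mono[OF assms(2)[OF less.prems(1) False]], elim conjE)
      fix t1 \<tau>
      assume t1: "t1 \<le> B" and I: "I \<tau>" and V: "V \<tau> < V \<sigma>"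
      show "wp W S (While b c) \<tau> (\<lambda>t2 \<tau>'. Q (1 + cost b + t1 + t2) \<tau>')"
      proof (rule less.hyps[OF V I])
        fix t \<tau>'
        assume t: "t \<le> 1 + cost b + V \<tau> * (B + 1 + cost b)" and *: "I \<tau>'" "eval b \<tau>' = 0"
        have "Suc (V \<tau>) * (B + 1 + cost b) \<le> V \<sigma> * (B + 1 + cost b)"
          using V by (intro mult_le_mono1) simp
        with t t1 have "1 + cost b + t1 + t \<le> 1 + cost b + V \<sigma> * (B + 1 + cost b)" by simp
        then show "Q (1 + cost b + t1 + t) \<tau>'" using * by (rule less.prems)
      qed
    qed
    with False show ?thesis by (rule wp_While_True)
  qed
qed

text \<open>For a known number of iterations the invariant carries the iteration index, and the
  index decides the test. The induction is on the iterations left.\<close>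

lemma wp_For:
  assumes "I 0 \<sigma>"
    and "\<And>k \<tau>. k < N \<Longrightarrow> I k \<tau> \<Longrightarrow> eval b \<tau> \<noteq> 0"
    and "\<And>k \<tau>. k < N \<Longrightarrow> I k \<tau> \<Longrightarrow> wp W S c \<tau> (\<lambda>t \<tau>'. t \<le> B \<and> I (Suc k) \<tau>')"
    and "\<And>\<tau>. I N \<tau> \<Longrightarrow> eval b \<tau> = 0"
    and "\<And>t \<tau>. t \<le> 1 + cost b + N * (B + 1 + cost b) \<Longrightarrow> I N \<tau> \<Longrightarrow> Q t \<tau>"
  shows "wp W S (While b c) \<sigma> Q"
proof -
  have "wp W S (While b c) \<sigma> Q" if "k \<le> N" "I k \<sigma>"
    "\<And>t \<tau>. t \<le> 1 + cost b + (N - k) * (B + 1 + cost b) \<Longrightarrow> I N \<tau> \<Longrightarrow> Q t \<tau>" for k \<sigma> Q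
    using that
  proof (induction "N - k" arbitrary: k \<sigma> Q)
    case 0
    then show ?case using assms(4) by (intro wp_While_False) auto
  next
    case (Suc r)
    then have k: "k < N" by simp
    have "wp W S c \<sigma> (\<lambda>t1 \<tau>. wp W S (While b c) \<tau> (\<lambda>t2 \<tau>'. Q (1 + cost b + t1 + t2) \<tau>'))"
    proof (rule wp_mono[OF assms(3)[OF k Suc.prems(2)]], elim conjE)
      fix t1 \<tau>
      assume t1: "t1 \<le> B" and I: "I (Suc k) \<tau>"
      show "wp W S (While b c) \<tau> (\<lambda>t2 \<tau>'. Q (1 + cost b + t1 + t2) \<tau>')"
      proof (rule Suc.hyps(1)[OF _ _ I])
        fix t \<tau>'
        assume t: "t \<le> 1 + cost b + (N - Suc k) * (B + 1 + cost b)" and *: "I N \<tau>'"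
        have "N - k = Suc (N - Suc k)" using k by simp
        with t t1 have "1 + cost b + t1 + t \<le> 1 + cost b + (N - k) * (B + 1 + cost b)" by simp
        then show "Q (1 + cost b + t1 + t) \<tau>'" using * by (rule Suc.prems)
      qed (use Suc.hyps(2) k in auto)
    qed
    with assms(2)[OF k Suc.prems(2)] show ?case by (rule wp_While_True)
  qed
  from this[of 0] assms(1,5) show ?thesis by simp
qed

section \<open>Searching the local memory\<close>

abbreviation seq (infixr ";;" 60) where "c1 ;; c2 \<equiv> Seq c1 c2"

text \<open>Afterwards registers 6, 7 and 8 hold \<open>w\<close>, \<open>g * w\<close> and \<open>g\<close>.\<close>

definition setup_regs :: com where
  "setup_regs =
     Assign 6 (Plus (Div (Reg 0) (Reg 1)) (Lit 1)) ;;
     Assign 7 (Div (Reg 2) (Lit 72)) ;;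
     Assign 8 (Div (Reg 7) (Reg 6))"

definition incr :: "nat \<Rightarrow> com" where
  "incr r = Assign r (Plus (Reg r) (Lit 1))"

definition for_loop :: "nat \<Rightarrow> nat \<Rightarrow> com \<Rightarrow> com" where
  "for_loop r b c = Assign r (Lit 0) ;; While (Less (Reg r) (Reg b)) (c ;; incr r)"

text \<open>Exchange sort. Its quadratic cost is affordable, because one linear two-pointer pass per
  word of \<open>C\<close> is quadratic anyway.\<close>

definition sort_memory :: com where
  "sort_memory =
     for_loop 6 4 (for_loop 7 6
       (If (Less (Load (Reg 6)) (Load (Reg 7)))
         (Assign 8 (Load (Reg 6)) ;; Store (Reg 6) (Load (Reg 7)) ;; Store (Reg 7) (Reg 8))
         Skip))"

text \<open>The word \<open>3 * v + l\<close> stands for the value \<open>v\<close> of list \<open>l\<close>; sorting words sorts values.\<close>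

definition two_pointers :: com where
  "two_pointers =
     Assign 7 (Lit 0) ;;
     Assign 8 (Minus (Reg 4) (Lit 1)) ;;
     While (Times (Less (Reg 7) (Reg 4)) (Less (Lit (-1)) (Reg 8)))
       (If (Plus (Less (Lit 0) (Mod (Load (Reg 7)) (Lit 3)))
              (Times (Equal (Mod (Load (Reg 8)) (Lit 3)) (Lit 1))
                 (Less (Plus (Div (Load (Reg 7)) (Lit 3)) (Div (Load (Reg 8)) (Lit 3)))
                    (Div (Load (Reg 6)) (Lit 3)))))
         (incr 7)
         (If (Times (Equal (Mod (Load (Reg 8)) (Lit 3)) (Lit 1))
                (Equal (Plus (Div (Load (Reg 7)) (Lit 3)) (Div (Load (Reg 8)) (Lit 3)))
                    (Div (Load (Reg 6)) (Lit 3))))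
            (Assign 5 (Lit 1)) Skip ;;
          Assign 8 (Minus (Reg 8) (Lit 1))))"

definition search :: com where
  "search =
     sort_memory ;;
     for_loop 6 4 (If (Equal (Mod (Load (Reg 6)) (Lit 3)) (Lit 2)) two_pointers Skip)"

text \<open>Outside the iterations 2 steps initialise the counter and 4 are the failing test; each
  iteration adds 4 for the test and 4 for the increment. The body has to preserve both control
  registers, and its invariant is stated for the state after the increment.\<close>

lemma wp_for_loop:
  assumes "1 \<le> W" "r \<noteq> b" "regs \<sigma> b = int N" "int N \<le> W"
    and "I 0 (\<sigma>\<lparr>regs := (regs \<sigma>)(r := 0)\<rparr>)"
    and "\<And>k \<tau>. k < N \<Longrightarrow> I k \<tau> \<Longrightarrow> regs \<tau> r = int k \<Longrightarrow> regs \<tau> b = int N \<Longrightarrow>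
      wp W S c \<tau> (\<lambda>t \<tau>'. t \<le> B \<and> regs \<tau>' r = int k \<and> regs \<tau>' b = int N \<and>
        I (Suc k) (\<tau>'\<lparr>regs := (regs \<tau>')(r := int (Suc k))\<rparr>))"
    and "\<And>t \<tau>. t \<le> 6 + N * (B + 8) \<Longrightarrow> I N \<tau> \<Longrightarrow> regs \<tau> r = int N \<Longrightarrow> regs \<tau> b = int N \<Longrightarrow> Q t \<tau>"
  shows "wp W S (for_loop r b c) \<sigma> Q"
proof -
  let ?\<sigma> = "\<sigma>\<lparr>regs := (regs \<sigma>)(r := 0)\<rparr>"
  have "wp W S (While (Less (Reg r) (Reg b)) (c ;; incr r)) ?\<sigma> (\<lambda>t \<tau>. Q (2 + t) \<tau>)"
  proof (rule wp_For[where N = N and B = "B + 4" and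
        I = "\<lambda>k \<tau>. I k \<tau> \<and> regs \<tau> r = int k \<and> regs \<tau> b = int N"])
    fix k \<tau>
    assume k: "k < N" and I: "I k \<tau> \<and> regs \<tau> r = int k \<and> regs \<tau> b = int N"
    show "wp W S (c ;; incr r) \<tau> (\<lambda>t \<tau>'. t \<le> B + 4 \<and> I (Suc k) \<tau>' \<and> regs \<tau>' r = int (Suc k)
        \<and> regs \<tau>' b = int N)"
      unfolding wp_Seq incr_def
      by (rule wp_mono[OF assms(6)[OF k]]) (use I assms(1,2,4) k in \<open>auto simp: add.commute\<close>)
  qed (use assms in \<open>auto simp: algebra_simps\<close>)
  then show ?thesis unfolding for_loop_def using assms(1) by simp
qed

section \<open>Sorting by exchanges\<close>

definition contents :: "nat \<Rightarrow> (int \<Rightarrow> int) \<Rightarrow> int set" where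
  "contents L \<mu> = (\<lambda>p. \<mu> (int p)) ` {..<L}"

definition ordered :: "nat \<Rightarrow> (int \<Rightarrow> int) \<Rightarrow> bool" where
  "ordered L \<mu> \<longleftrightarrow> (\<forall>p q. p \<le> q \<longrightarrow> q < L \<longrightarrow> \<mu> (int p) \<le> \<mu> (int q))"

text \<open>A set is enough as invariant, since the answer depends only on which words occur. One
  inclusion yields both, because swapping twice restores the memory.\<close>

lemma contents_swap:
  assumes "i < L" "j < L"
  shows "contents L (\<mu>(int i := \<mu> (int j), int j := \<mu> (int i))) = contents L \<mu>"
proof -
  have sub: "contents L (\<nu>(int i := \<nu> (int j), int j := \<nu> (int i))) \<subseteq> contents L \<nu>" for \<nu>
    using assms unfolding contents_def by auto
  have "\<mu> = (\<mu>(int i := \<mu> (int j), int j := \<mu> (int i)))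
      (int i := (\<mu>(int i := \<mu> (int j), int j := \<mu> (int i))) (int j),
       int j := (\<mu>(int i := \<mu> (int j), int j := \<mu> (int i))) (int i))"
    by (auto simp: fun_eq_iff)
  then show ?thesis
    using sub[of \<mu>] sub[of "\<mu>(int i := \<mu> (int j), int j := \<mu> (int i))"] by (metis equalityI)
qed

text \<open>Step of the inner loop: position \<open>i\<close> collects the maximum of the entries
  compared so far. Its old value is at least everything before \<open>j\<close> and smaller than
  entry \<open>j\<close>, so it fits into place \<open>j\<close>.\<close>

lemma ordered_swap:
  assumes "j < i" "ordered i \<mu>" "\<forall>p<j. \<mu> (int p) \<le> \<mu> (int i)" "\<mu> (int i) < \<mu> (int j)"
  defines "\<mu>' \<equiv> \<mu>(int i := \<mu> (int j), int j := \<mu> (int i))"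
  shows "ordered i \<mu>'" "\<forall>p<Suc j. \<mu>' (int p) \<le> \<mu>' (int i)"
proof -
  have o: "\<mu> (int p) \<le> \<mu> (int q)" if "p \<le> q" "q < i" for p q
    using assms(2) that unfolding ordered_def by blast
  show "ordered i \<mu>'"
    unfolding ordered_def
  proof (intro allI impI)
    fix p q
    assume pq: "p \<le> q" "q < i"
    consider "q < j" | "q = j" | "j < q" "p = j" | "j < q" "p \<noteq> j" by linarith
    then show "\<mu>' (int p) \<le> \<mu>' (int q)"
      using pq o[OF pq] o[of j q] assms(1,3,4) unfolding \<mu>'_def by cases (auto simp: le_less)
  qed
  show "\<forall>p<Suc j. \<mu>' (int p) \<le> \<mu>' (int i)"
    using o[of _ j] assms(1,4) unfolding \<mu>'_def by (auto simp: less_Suc_eq)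
qed

lemma ordered_Suc:
  assumes "ordered i \<mu>" "\<forall>p<i. \<mu> (int p) \<le> \<mu> (int i)"
  shows "ordered (Suc i) \<mu>"
  using assms unfolding ordered_def by (metis le_less less_Suc_eq)

lemma wp_sort_memory:
  assumes "1 \<le> W" "regs \<sigma> 4 = int L" "L \<le> S" "int L \<le> W" "\<forall>v\<in>contents L (mem \<sigma>). \<bar>v\<bar> \<le> W"
    and Q: "\<And>t \<tau>. t \<le> 6 + L * (24 * L + 14) \<Longrightarrow> regs \<tau> 4 = int L \<Longrightarrow> regs \<tau> 5 = regs \<sigma> 5 \<Longrightarrow>
      contents L (mem \<tau>) = contents L (mem \<sigma>) \<Longrightarrow> ordered L (mem \<tau>) \<Longrightarrow> Q t \<tau>"
  shows "wp W S sort_memory \<sigma> Q"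
proof -
  define I where "I = (\<lambda>i (\<tau>::state). regs \<tau> 4 = int L \<and> regs \<tau> 5 = regs \<sigma> 5 \<and>
    contents L (mem \<tau>) = contents L (mem \<sigma>) \<and> ordered i (mem \<tau>))"
  have mem: "\<bar>mem \<tau> (int p)\<bar> \<le> W" if "I i \<tau>" "p < L" for i \<tau> p
    using that assms(5) unfolding I_def contents_def by fastforce
  show ?thesis
    unfolding sort_memory_def
  proof (rule wp_for_loop[where N = L and I = I and B = "24 * L + 6"])
    fix i \<tau>
    assume i: "i < L" and I: "I i \<tau>" and r: "regs \<tau> 6 = int i" "regs \<tau> 4 = int L"
    show "wp W S (for_loop 7 6
       (If (Less (Load (Reg 6)) (Load (Reg 7)))
         (Assign 8 (Load (Reg 6)) ;; Store (Reg 6) (Load (Reg 7)) ;; Store (Reg 7) (Reg 8))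
         Skip)) \<tau> (\<lambda>t \<tau>'. t \<le> 24 * L + 6 \<and> regs \<tau>' 6 = int i \<and> regs \<tau>' 4 = int L \<and>
            I (Suc i) (\<tau>'\<lparr>regs := (regs \<tau>')(6 := int (Suc i))\<rparr>))"
    proof (rule wp_for_loop[where N = i and B = 16 and
          I = "\<lambda>j \<tau>. I i \<tau> \<and> regs \<tau> 6 = int i \<and> (\<forall>p<j. mem \<tau> (int p) \<le> mem \<tau> (int i))"], goal_cases)
      case (6 j \<tau>)
      then show ?case
        using i assms(3) mem[of i \<tau> i] mem[of i \<tau> j] contents_swap[of i L j "mem \<tau>"]
          ordered_swap[of j i "mem \<tau>"]
        by (auto simp: I_def less_Suc_eq)
    next
      case (7 t \<tau>)
      then show ?case using i ordered_Suc[of i "mem \<tau>"]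
        by (auto simp: I_def)
    qed (use i I r assms in \<open>auto simp: I_def\<close>)
  qed (use assms in \<open>auto simp: I_def ordered_def add_ac\<close>)
qed

text \<open>Both pointers run over the same mixed memory, for the fixed word of \<open>C\<close> at
  \<open>k\<close>: the lower one stops at words of \<open>A\<close>, the upper one at words of
  \<open>B\<close>. Register 5 may have been set for an earlier \<open>k\<close>, hence the
  disjunction with its old value.\<close>

lemma wp_two_pointers:
  assumes "1 \<le> W" "regs \<sigma> 4 = int L" "int L \<le> W" "regs \<sigma> 6 = int k" "ordered L (mem \<sigma>)"
  defines "hit \<equiv> \<lambda>p q. mem \<sigma> (int p) mod 3 = 0 \<and> mem \<sigma> (int q) mod 3 = 1 \<and>
    mem \<sigma> (int p) div 3 + mem \<sigma> (int q) div 3 = mem \<sigma> (int k) div 3"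
  assumes Q: "\<And>t \<tau>. t \<le> 15 + 140 * L \<Longrightarrow> regs \<tau> 4 = int L \<Longrightarrow> regs \<tau> 6 = int k \<Longrightarrow> mem \<tau> = mem \<sigma> \<Longrightarrow>
      regs \<tau> 5 \<noteq> 0 \<longleftrightarrow> regs \<sigma> 5 \<noteq> 0 \<or> (\<exists>p<L. \<exists>q<L. hit p q) \<Longrightarrow> Q t \<tau>"
  shows "wp W S two_pointers \<sigma> Q"
proof -
  \<comment> \<open>\<open>hi\<close> is one more than register 8, so the exhausted pointer -1
    becomes \<open>hi = 0\<close>. Until something is reported, all hits lie between the pointers;
    afterwards nothing more is claimed about them.\<close>
  define I where "I = (\<lambda>\<tau>::state. regs \<tau> 4 = int L \<and> regs \<tau> 6 = int k \<and> mem \<tau> = mem \<sigma> \<and>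
    (\<exists>lo hi. regs \<tau> 7 = int lo \<and> regs \<tau> 8 = int hi - 1 \<and> lo \<le> L \<and> hi \<le> L \<and>
      (regs \<tau> 5 \<noteq> 0 \<longrightarrow> regs \<sigma> 5 \<noteq> 0 \<or> (\<exists>p<L. \<exists>q<L. hit p q)) \<and>
      (regs \<sigma> 5 \<noteq> 0 \<longrightarrow> regs \<tau> 5 \<noteq> 0) \<and>
      (\<forall>p<L. \<forall>q<L. hit p q \<longrightarrow> regs \<tau> 5 \<noteq> 0 \<or> lo \<le> p \<and> q < hi)))"
  have I_intro: "I \<tau>" if "regs \<tau> 4 = int L" "regs \<tau> 6 = int k" "mem \<tau> = mem \<sigma>"
    "regs \<tau> 7 = int lo" "regs \<tau> 8 = int hi - 1" "lo \<le> L" "hi \<le> L" "regs \<tau> 5 = r"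
    "r \<noteq> 0 \<longrightarrow> regs \<sigma> 5 \<noteq> 0 \<or> (\<exists>p<L. \<exists>q<L. hit p q)"
    "regs \<sigma> 5 \<noteq> 0 \<longrightarrow> r \<noteq> 0"
    "\<forall>p<L. \<forall>q<L. hit p q \<longrightarrow> r \<noteq> 0 \<or> lo \<le> p \<and> q < hi" for \<tau> lo hi r
    unfolding I_def using that by blast
  have div_mono: "mem \<sigma> (int p) div 3 \<le> mem \<sigma> (int q) div 3" if "p \<le> q" "q < L" for p q
    using that assms(5) unfolding ordered_def by (simp add: zdiv_mono1)
  show ?thesis
    unfolding two_pointers_def wp_Seq wp_Assign
  proof (intro conjI, goal_cases)
    case 3
    show ?case
    \<comment> \<open>Every iteration moves one pointer by one; \<open>V\<close> counts the moves
      left, \<open>2 * L\<close> at the start.\<close>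
    proof (rule wp_While[where I = I and B = 60 and
          V = "\<lambda>\<tau>. nat (int L - regs \<tau> 7) + nat (regs \<tau> 8 + 1)"], goal_cases)
      case 1
      then show ?case
        using assms(2,4) unfolding I_def
        by simp
    next
      case (2 \<tau>)
      then obtain lo hi where *: "regs \<tau> 4 = int L" "regs \<tau> 6 = int k" "mem \<tau> = mem \<sigma>"
        "regs \<tau> 7 = int lo" "regs \<tau> 8 = int hi - 1" "lo < L" "hi \<le> L" "0 < hi"
        "regs \<tau> 5 \<noteq> 0 \<longrightarrow> regs \<sigma> 5 \<noteq> 0 \<or> (\<exists>p<L. \<exists>q<L. hit p q)"
        "regs \<sigma> 5 \<noteq> 0 \<longrightarrow> regs \<tau> 5 \<noteq> 0"
        "\<forall>p<L. \<forall>q<L. hit p q \<longrightarrow> regs \<tau> 5 \<noteq> 0 \<or> lo \<le> p \<and> q < hi"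
        unfolding I_def by (auto split: if_splits)
      define h where "h = hi - 1"
      have h: "hi = Suc h" "int hi - 1 = int h" "h < L" using *(7,8) unfolding h_def by auto
      let ?c = "mem \<sigma> (int lo) mod 3 \<noteq> 0 \<or> mem \<sigma> (int h) mod 3 = 1 \<and>
        mem \<sigma> (int lo) div 3 + mem \<sigma> (int h) div 3 < mem \<sigma> (int k) div 3"
      have pos: "0 < mem \<sigma> (int lo) mod 3 \<longleftrightarrow> mem \<sigma> (int lo) mod 3 \<noteq> 0"
        by (simp add: order.strict_iff_order)
      let ?e1 = "Plus (Less (Lit 0) (Mod (Load (Reg 7)) (Lit 3)))
              (Times (Equal (Mod (Load (Reg 8)) (Lit 3)) (Lit 1))
                 (Less (Plus (Div (Load (Reg 7)) (Lit 3)) (Div (Load (Reg 8)) (Lit 3)))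
                    (Div (Load (Reg 6)) (Lit 3))))"
      let ?e2 = "Times (Equal (Mod (Load (Reg 8)) (Lit 3)) (Lit 1))
                (Equal (Plus (Div (Load (Reg 7)) (Lit 3)) (Div (Load (Reg 8)) (Lit 3)))
                    (Div (Load (Reg 6)) (Lit 3)))"
      show ?case
      proof (cases ?c)
        case True
        have "lo \<noteq> p" if "hit p q" "q < hi" for p q
          using that True div_mono[of q h] h unfolding hit_def by auto
        then have new: "\<forall>p<L. \<forall>q<L. hit p q \<longrightarrow> regs \<tau> 5 \<noteq> 0 \<or> Suc lo \<le> p \<and> q < hi"
          using *(11) by (simp add: Suc_le_eq less_le)
        have e1: "eval ?e1 \<tau> \<noteq> 0"
          using True pos *(1-5) h(2) by auto
        have "I (\<tau>\<lparr>regs := (regs \<tau>)(7 := int lo + 1)\<rparr>)"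
          by (rule I_intro[OF _ _ _ _ _ _ _ _ *(9,10) new]) (use *(1-8) in simp_all)
        then show ?thesis
          using *(1-8) assms(3) unfolding wp_If if_P[OF e1] incr_def by simp
      next
        case False
        have le: "mem \<sigma> (int lo) mod 3 = 0"
          "mem \<sigma> (int h) mod 3 = 1 \<Longrightarrow>
            mem \<sigma> (int lo) div 3 + mem \<sigma> (int h) div 3 \<ge> mem \<sigma> (int k) div 3"
          using False by auto
        have "h \<noteq> q" if "hit p q" "lo \<le> p" "p < L" "\<not> hit lo h" for p q
          using that le div_mono[of lo p] unfolding hit_def by auto
        then have new: "\<forall>p<L. \<forall>q<L. hit p q \<longrightarrow> regs \<tau> 5 \<noteq> 0 \<or> hit lo h \<or> lo \<le> p \<and> q < h"
          using *(11) unfolding h(1) less_Suc_eq by (metis (lifting))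
        have e1: "\<not> eval ?e1 \<tau> \<noteq> 0"
          using False pos *(1-5) h(2) by auto
        have e2: "eval ?e2 \<tau> \<noteq> 0 \<longleftrightarrow> hit lo h"
          using le *(1-5) h(2) unfolding hit_def by auto
        show ?thesis
        proof (cases "hit lo h")
          case True
          have "1 \<noteq> (0::int) \<longrightarrow> regs \<sigma> 5 \<noteq> 0 \<or> (\<exists>p<L. \<exists>q<L. hit p q)"
            using True *(6) h(3) by blast
          then have "I (\<tau>\<lparr>regs := (regs \<tau>)(5 := 1, 8 := int h - 1)\<rparr>)"
            by (rule I_intro[where lo = lo and hi = h, rotated 8]) (use *(1-8) h in \<open>simp_all add: less_imp_le\<close>)
          moreover have "eval ?e2 \<tau> \<noteq> 0" using e2 True by blast
          ultimately show ?thesis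
            using *(1-8) assms(1,3) h unfolding wp_If if_not_P[OF e1] wp_Seq
            by (simp; intro conjI; linarith)
        next
          case False
          with new have new': "\<forall>p<L. \<forall>q<L. hit p q \<longrightarrow> regs \<tau> 5 \<noteq> 0 \<or> lo \<le> p \<and> q < h" by blast
          have "I (\<tau>\<lparr>regs := (regs \<tau>)(8 := int h - 1)\<rparr>)"
            by (rule I_intro[OF _ _ _ _ _ _ _ _ *(9,10) new']) (use *(1-8) h in \<open>simp_all add: less_imp_le\<close>)
          moreover have "\<not> eval ?e2 \<tau> \<noteq> 0" using e2 False by blast
          ultimately show ?thesis
            using *(1-8) assms(1,3) h unfolding wp_If if_not_P[OF e1] wp_Seq
            by (simp; intro conjI; linarith)
        qed
      qed
    next
      case (3 t \<tau>)
      then obtain lo hi where *: "regs \<tau> 4 = int L" "regs \<tau> 6 = int k" "mem \<tau> = mem \<sigma>"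
        "regs \<tau> 7 = int lo" "regs \<tau> 8 = int hi - 1" "L \<le> lo \<or> hi = 0" "lo \<le> L" "hi \<le> L"
        "regs \<tau> 5 \<noteq> 0 \<longrightarrow> regs \<sigma> 5 \<noteq> 0 \<or> (\<exists>p<L. \<exists>q<L. hit p q)"
        "regs \<sigma> 5 \<noteq> 0 \<longrightarrow> regs \<tau> 5 \<noteq> 0"
        "\<forall>p<L. \<forall>q<L. hit p q \<longrightarrow> regs \<tau> 5 \<noteq> 0 \<or> lo \<le> p \<and> q < hi"
        unfolding I_def by (auto split: if_splits)
      have stop: "regs \<tau> 5 \<noteq> 0" if "p < L" "q < L" "hit p q" for p q
        using *(6) *(11)[rule_format, OF that] that by linarith
      have "regs \<tau> 5 \<noteq> 0 \<longleftrightarrow> regs \<sigma> 5 \<noteq> 0 \<or> (\<exists>p<L. \<exists>q<L. hit p q)"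
        using *(9,10) stop by blast
      with * 3(1) assms(2) show ?case by (intro Q) auto
    qed
  qed (use assms in auto)
qed

text \<open>\<open>div 3\<close> and \<open>mod 3\<close> recover value and list tag, for negative
  values too, since \<open>mod 3\<close> lies between 0 and 2.\<close>

lemma coded_solution_iff:
  fixes v :: "nat \<Rightarrow> int"
  shows "(\<exists>j<L. v j mod 3 = 2 \<and>
      (\<exists>p<L. \<exists>q<L. v p mod 3 = 0 \<and> v q mod 3 = 1 \<and> v p div 3 + v q div 3 = v j div 3)) \<longleftrightarrow>
    (\<exists>a b. 3 * a \<in> v ` {..<L} \<and> 3 * b + 1 \<in> v ` {..<L} \<and> 3 * (a + b) + 2 \<in> v ` {..<L})"
    (is "?l \<longleftrightarrow> ?r")
proof
  assume ?l
  then obtain j p q where *: "j < L" "v j mod 3 = 2" "p < L" "q < L" "v p mod 3 = 0"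
    "v q mod 3 = 1" "v p div 3 + v q div 3 = v j div 3" by (elim exE conjE)
  have "3 * (x div 3) + x mod 3 = x" for x :: int by simp
  from this[of "v p"] this[of "v q"] this[of "v j"]
  have "3 * (v p div 3) = v p" "3 * (v q div 3) + 1 = v q" "3 * (v p div 3 + v q div 3) + 2 = v j"
    unfolding *(2,5-7) add_0_right .
  then have "3 * (v p div 3) \<in> v ` {..<L}" "3 * (v q div 3) + 1 \<in> v ` {..<L}"
    "3 * (v p div 3 + v q div 3) + 2 \<in> v ` {..<L}" using *(1,3,4) by auto
  then show ?r by (intro exI conjI)
next
  assume ?r
  then obtain a b j p q where *: "j < L" "p < L" "q < L"
    "3 * a = v p" "3 * b + 1 = v q" "3 * (a + b) + 2 = v j" by blast
  have "3 * a mod 3 = 0" "3 * a div 3 = a" by simp_all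
  moreover have "(3 * b + 1) mod 3 = 1" "(3 * b + 1) div 3 = b" by simp_all
  moreover have "(3 * c + 2) mod 3 = 2" "(3 * c + 2) div 3 = c" for c :: int by simp_all
  ultimately have "v j mod 3 = 2" "v p mod 3 = 0" "v q mod 3 = 1" "v p div 3 + v q div 3 = v j div 3"
    unfolding *(4-6)[symmetric] by (simp_all only: refl)
  with *(1-3) show ?l by (intro exI[of _ j] exI[of _ p] exI[of _ q] conjI)
qed

lemma wp_search:
  assumes "1 \<le> W" "length ws \<le> S" "int (length ws) \<le> W" "\<forall>v\<in>set ws. \<bar>v\<bar> \<le> W"
  shows "wp W S search (start n M S m ws) (\<lambda>t \<tau>. t \<le> 200 * (length ws + 1)^2 \<and>
    (regs \<tau> 5 \<noteq> 0 \<longleftrightarrow> (\<exists>a b. 3 * a \<in> set ws \<and> 3 * b + 1 \<in> set ws \<and> 3 * (a + b) + 2 \<in> set ws)))"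
proof -
  define L where "L = length ws"
  let ?\<sigma> = "start n M S m ws"
  have contents: "contents L (mem ?\<sigma>) = set ws"
    by (auto simp: contents_def start_def L_def set_conv_nth image_iff Bex_def)
  show ?thesis
    unfolding search_def wp_Seq
  proof (rule wp_sort_memory[where L = L], goal_cases)
    case (6 t0 \<tau>0)
    note sorted = this
    let ?v = "\<lambda>p. mem \<tau>0 (int p)"
    define E where "E = (\<lambda>k. \<exists>p<L. \<exists>q<L. ?v p mod 3 = 0 \<and> ?v q mod 3 = 1 \<and> ?v p div 3 + ?v q div 3 = ?v k div 3)"
    have set: "set ws = ?v ` {..<L}"
      using sorted(4) contents unfolding contents_def by simp
    show ?case
    proof (rule wp_for_loop[where N = L and B = "22 + 140 * L" and
          I = "\<lambda>k \<tau>. mem \<tau> = mem \<tau>0 \<and> (regs \<tau> 5 \<noteq> 0 \<longleftrightarrow> (\<exists>j<k. ?v j mod 3 = 2 \<and> E j))"], goal_cases)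
      case 5
      then show ?case using sorted(3) by (simp add: start_def)
    next
      case (6 k \<tau>)
      show ?case
      proof (cases "?v k mod 3 = 2")
        case True
        have "wp W S two_pointers \<tau> (\<lambda>t \<tau>'. t \<le> 15 + 140 * L \<and> regs \<tau>' 6 = int k \<and>
            regs \<tau>' 4 = int L \<and> mem \<tau>' = mem \<tau>0 \<and> (regs \<tau>' 5 \<noteq> 0 \<longleftrightarrow> regs \<tau> 5 \<noteq> 0 \<or> E k))"
        proof (rule wp_two_pointers[where L = L and k = k], goal_cases)
          case (6 t \<tau>')
          moreover have "mem \<tau> = mem \<tau>0" using \<open>_ \<and> _\<close> by simp
          ultimately show ?case unfolding E_def by metis
        qed (use 6 sorted(5) assms in \<open>simp_all add: L_def\<close>)
        then show ?thesis
          unfolding wp_If using 6 True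
          by simp (erule wp_mono, auto simp: less_Suc_eq)
      next
        case False
        then show ?thesis using 6 by (auto simp: less_Suc_eq)
      qed
    next
      case (7 t \<tau>)
      \<comment> \<open>The sort contributes \<open>24 * L * L\<close> to the leading term, the at
        most \<open>L\<close> two-pointer passes \<open>140 * L * L\<close>.\<close>
      have "L * (30 + 140 * L) + 12 + L * (24 * L + 14) \<le> 200 * (L + 1)\<^sup>2"
        by (simp add: power2_eq_square algebra_simps)
      then have "t0 + t \<le> 200 * (length ws + 1)\<^sup>2"
        using sorted(1) 7(1) unfolding L_def[symmetric] by simp
      moreover have "regs \<tau> 5 \<noteq> 0 \<longleftrightarrow>
          (\<exists>a b. 3 * a \<in> set ws \<and> 3 * b + 1 \<in> set ws \<and> 3 * (a + b) + 2 \<in> set ws)"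
        using 7(2) coded_solution_iff[of L ?v] unfolding set E_def by simp
      ultimately show ?case by blast
    qed (use sorted assms in \<open>simp_all add: L_def\<close>)
  qed (use assms contents in \<open>auto simp: L_def start_def\<close>)
qed

section \<open>Distributing samples and matching blocks\<close>

text \<open>An inbox record is list, position, value, and goes to the \<open>g\<close> machines
  \<open>(i mod g, d)\<close>. List and position are packed into the one word
  \<open>l * (g * w) + i div g\<close>: the recipient knows the residue \<open>i mod g\<close> from
  its own number.\<close>

definition scatter :: com where
  "scatter =
     setup_regs ;;
     Assign 9 (Lit 0) ;;
     While (Less (Reg 9) (Reg 4))
       (for_loop 10 8
          (Send (Plus (Times (Mod (Load (Plus (Reg 9) (Lit 1))) (Reg 8)) (Reg 8)) (Reg 10))
             [Plus (Times (Load (Reg 9)) (Reg 7)) (Div (Load (Plus (Reg 9) (Lit 1))) (Reg 8)),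
              Load (Plus (Reg 9) (Lit 2))]) ;;
        Assign 9 (Plus (Reg 9) (Lit 3)))"

text \<open>The inbox has at most \<open>6 * g * w\<close> words; the three samples are stored above it.\<close>

definition load_sample :: com where
  "load_sample =
     Assign 9 (Lit 0) ;;
     While (Less (Reg 9) (Reg 4))
       (Store (Plus (Times (Lit 6) (Reg 7)) (Load (Reg 9))) (Load (Plus (Reg 9) (Lit 1))) ;;
        Assign 9 (Plus (Reg 9) (Lit 2)))"

text \<open>On a machine with residue \<open>x\<close>, sample entry \<open>t\<close> is list
  element \<open>t * g + x\<close>. So block \<open>b\<close> consists of the entries
  \<open>b * w\<close> to \<open>b * w + w - 1\<close>.\<close>

definition sample_at :: "nat \<Rightarrow> expr \<Rightarrow> expr" where
  "sample_at l t = Load (Plus (Times (Lit (6 + int l)) (Reg 7)) t)"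

definition in_sample :: "expr \<Rightarrow> expr" where
  "in_sample t = Less (Plus (Times t (Reg 8)) (Reg 9)) (Reg 0)"

text \<open>Together with \<open>after_block\<close>, the nearest sample entries outside a block;
  being outside they bound all its elements. Nothing precedes block 0, which is why the tests ask
  for positive block numbers.\<close>

definition before_block :: "nat \<Rightarrow> expr" where
  "before_block b = Minus (Times (Reg b) (Reg 6)) (Lit 1)"

definition after_block :: "nat \<Rightarrow> expr" where
  "after_block b = Times (Plus (Reg b) (Lit 1)) (Reg 6)"

definition nonempty_block :: "nat \<Rightarrow> expr" where
  "nonempty_block b = Less (Times (Times (Reg b) (Reg 6)) (Reg 8)) (Reg 0)"

text \<open>Registers 9 and 10 hold \<open>x\<close> and \<open>d\<close>, registers 12, 13 and 14 the block numbers \<open>i\<close>, \<open>j\<close> and \<open>k\<close>.\<close>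

definition too_big :: expr where
  "too_big =
     Times (Less (Lit 0) (Reg 12)) (Times (Less (Lit 0) (Reg 13))
       (Times (in_sample (after_block 14))
         (Less (sample_at 2 (after_block 14))
            (Plus (sample_at 0 (before_block 12)) (sample_at 1 (before_block 13))))))"

definition too_small :: expr where
  "too_small =
     Times (Less (Lit 0) (Reg 14)) (Times (in_sample (after_block 12))
       (Times (in_sample (after_block 13))
         (Less (Plus (sample_at 0 (after_block 12)) (sample_at 1 (after_block 13)))
            (sample_at 2 (before_block 14)))))"

text \<open>\<open>Times\<close> serves as conjunction without short circuit: sample entries out of
  range read an arbitrary memory word, and the factor 0 of the failed range test cancels its
  effect.\<close>

definition relevant_expr :: expr where
  "relevant_expr =
     Times (Times (nonempty_block 12) (Times (nonempty_block 13) (nonempty_block 14)))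
       (Times (Equal too_big (Lit 0)) (Equal too_small (Lit 0)))"

definition send_element :: "nat \<Rightarrow> nat \<Rightarrow> com" where
  "send_element l b =
     If (in_sample (Plus (Times (Reg b) (Reg 6)) (Reg 15)))
       (Send (Plus (Times (Reg 10) (Reg 8)) (Reg 11))
          [Plus (Times (Lit 3) (sample_at l (Plus (Times (Reg b) (Reg 6)) (Reg 15)))) (Lit (int l))])
       Skip"

text \<open>Register 11 runs over the residue \<open>q\<close> of \<open>i + k\<close>, register 12
  over \<open>i\<close>. With the diagonal \<open>d\<close> they determine \<open>j\<close> and
  \<open>k\<close>, and the elements go to machine \<open>(d, q)\<close>.\<close>

definition match_blocks :: com where
  "match_blocks =
     setup_regs ;;
     load_sample ;;
     Assign 9 (Div (Reg 3) (Reg 8)) ;;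
     Assign 10 (Mod (Reg 3) (Reg 8)) ;;
     for_loop 11 8 (for_loop 12 8
       (Assign 13 (Mod (Minus (Reg 12) (Reg 10)) (Reg 8)) ;;
        Assign 14 (Mod (Minus (Reg 11) (Reg 12)) (Reg 8)) ;;
        If relevant_expr
          (for_loop 15 6 (send_element 0 12 ;; send_element 1 13 ;; send_element 2 14))
          Skip))"

text \<open>Truth values occur only in tests against 0. Rewriting these tests keeps the nested
  products from being expanded.\<close>

lemma eval_Times_nonzero: "eval (Times a b) \<tau> \<noteq> 0 \<longleftrightarrow> eval a \<tau> \<noteq> 0 \<and> eval b \<tau> \<noteq> 0"
  by simp

lemma eval_Less_nonzero: "eval (Less a b) \<tau> \<noteq> 0 \<longleftrightarrow> eval a \<tau> < eval b \<tau>"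
  by simp

lemma eval_Equal_nonzero: "eval (Equal a (Lit 0)) \<tau> \<noteq> 0 \<longleftrightarrow> \<not> eval a \<tau> \<noteq> 0"
  by simp

section \<open>Records laid out in a flat list of words\<close>

lemma length_concat_uniform:
  "(\<And>x. length (f x) = c) \<Longrightarrow> length (concat (map f xs)) = c * length xs"
  by (induction xs) auto

lemma nth_concat_uniform:
  assumes "\<And>x. length (f x) = c" "k < length xs" "r < c"
  shows "concat (map f xs) ! (c * k + r) = f (xs ! k) ! r"
  using assms(2)
proof (induction xs arbitrary: k)
  case (Cons x xs)
  then show ?case using assms(1,3) by (cases k) (auto simp: nth_append algebra_simps)
qed simp

lemma mem_start: "a < length ws \<Longrightarrow> mem (start n M S m ws) (int a) = ws ! a"
  by (simp add: start_def)

text \<open>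
  \<open>F l i\<close> is element \<open>i\<close> of list \<open>l\<close>; a list has \<open>g\<close> blocks of \<open>g * w\<close> elements, the last ones
  possibly incomplete or empty.
\<close>

locale grid =
  fixes n g w :: nat and W :: int and F :: "nat \<Rightarrow> nat \<Rightarrow> int"
  assumes g_pos: "0 < g"
    and w_def: "w = n div (g * g) + 1"
    and word_size: "int (72 * (g * w)) \<le> W" "int (g * g) \<le> W" "int n \<le> W"
    and word_value: "l < 3 \<Longrightarrow> i < n \<Longrightarrow> 3 * \<bar>F l i\<bar> + 2 \<le> W"
    and increasing: "l < 3 \<Longrightarrow> i < i' \<Longrightarrow> i' < n \<Longrightarrow> F l i < F l i'"
begin

abbreviation "S \<equiv> 72 * (g * w)"

lemma w_pos: "0 < w"
  by (simp add: w_def)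

text \<open>The \<open>+ 1\<close> in \<open>w_def\<close> rounds up, so that \<open>g\<close>
  blocks of \<open>g * w\<close> elements cover a list.\<close>

lemma size_less: "n < w * g * g"
proof -
  have "n div (g * g) * (g * g) + n mod (g * g) = n" by (rule div_mult_mod_eq)
  moreover have "n mod (g * g) < g * g" using g_pos by simp
  ultimately show ?thesis unfolding w_def by (simp add: algebra_simps)
qed

lemma div_less: "i < n \<Longrightarrow> i div g < g * w"
  using size_less by (intro less_mult_imp_div_less) (simp add: algebra_simps)

lemma word_small: "a \<le> S \<Longrightarrow> \<bar>int a\<bar> \<le> W"
  using word_size(1) by linarith

lemma g_le: "g \<le> g * w" and w_le: "w \<le> g * w"
  using g_pos w_pos by auto

lemma words_le: "int g \<le> W" "int w \<le> W" "int (g * w) \<le> W"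
  using word_small[of g] word_small[of w] word_small[of "g * w"] g_le w_le by linarith+

lemma W_pos: "1 \<le> W"
  using word_small[of 1] g_pos w_pos by simp

lemma value_fits_word: "l < 3 \<Longrightarrow> i < n \<Longrightarrow> \<bar>F l i\<bar> \<le> W"
  "l < 3 \<Longrightarrow> i < n \<Longrightarrow> \<bar>3 * F l i + int l\<bar> \<le> W"
  using word_value[of l i] by linarith+

text \<open>The program text does not mention \<epsilon>; it recovers the grid from what a machine
  knows: \<open>g * g\<close> is the number of machines and gives \<open>w\<close>, the memory size
  gives \<open>g * w\<close>, and their quotient is \<open>g\<close>.\<close>

lemma wp_setup_regs:
  assumes "regs \<sigma> 0 = int n" "regs \<sigma> 1 = int (g * g)" "regs \<sigma> 2 = int S"
  shows "wp W S setup_regs \<sigma> Q \<longleftrightarrow>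
    Q 14 (\<sigma>\<lparr>regs := (regs \<sigma>)(6 := int w, 7 := int (g * w), 8 := int g)\<rparr>)"
proof -
  have 1: "int n div int (g * g) + 1 = int w" unfolding w_def by (simp add: zdiv_int)
  have 2: "int S div 72 = int (g * w)" by (simp add: zdiv_int)
  have 3: "int (g * w) div int w = int g" using w_pos by simp
  show ?thesis
    unfolding setup_regs_def
    using words_le 1 2 3 assms by (simp del: of_nat_mult add: eval_nat_numeral)
qed

section \<open>First round: spreading and storing the samples\<close>

definition key_address :: "nat \<times> nat \<Rightarrow> nat" where
  "key_address = (\<lambda>(l, i). l * (g * w) + i div g)"

lemma key_address_less: "l < 3 \<Longrightarrow> i < n \<Longrightarrow> key_address (l, i) < 3 * (g * w)"
proof -
  assume "l < 3" "i < n"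
  then have "l * (g * w) \<le> 2 * (g * w)" by (intro mult_le_mono1) simp
  with div_less[OF \<open>i < n\<close>] show ?thesis unfolding key_address_def prod.case by linarith
qed

definition scatter_msgs :: "nat \<times> nat \<Rightarrow> (int \<times> int list) list" where
  "scatter_msgs = (\<lambda>(l, i). map (\<lambda>d. (int ((i mod g) * g + d), [int (key_address (l, i)), F l i])) [0..<g])"

lemma wp_scatter:
  assumes recs: "\<And>l i. (l, i) \<in> set recs \<Longrightarrow> l < 3 \<and> i < n" and len: "length recs \<le> 3 * w"
  defines "ws \<equiv> concat (map (\<lambda>(l, i). [int l, int i, F l i]) recs)"
  shows "wp W S scatter (start n (g * g) S m ws) (\<lambda>t \<tau>.
    t \<le> 300 * (g * w) \<and> sent \<tau> = concat (map scatter_msgs recs))"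
proof -
  let ?\<sigma> = "start n (g * g) S m ws"
  let ?N = "length recs"
  have lws: "length ws = 3 * ?N"
    unfolding ws_def by (intro length_concat_uniform) (simp split: prod.split)
  have mem: "mem ?\<sigma> (3 * int k) = int l" "mem ?\<sigma> (3 * int k + 1) = int i"
    "mem ?\<sigma> (3 * int k + 2) = F l i" if "k < ?N" "recs ! k = (l, i)" for k l i
  proof -
    have *: "mem ?\<sigma> (int (3 * k + r)) = [int l, int i, F l i] ! r" if "r < 3" for r
    proof -
      have "3 * k + r < length ws" using that \<open>k < ?N\<close> unfolding lws by linarith
      then have "mem ?\<sigma> (int (3 * k + r)) = ws ! (3 * k + r)" by (rule mem_start)
      also have "\<dots> = (\<lambda>(l, i). [int l, int i, F l i]) (recs ! k) ! r"
        unfolding ws_def using that \<open>k < ?N\<close>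
        by (intro nth_concat_uniform) (auto split: prod.split)
      finally show ?thesis unfolding \<open>recs ! k = _\<close> by simp
    qed
    show "mem ?\<sigma> (3 * int k) = int l" "mem ?\<sigma> (3 * int k + 1) = int i"
      "mem ?\<sigma> (3 * int k + 2) = F l i"
      using *[of 0] *[of 1] *[of 2] by (simp_all add: add.commute)
  qed
  define I where "I = (\<lambda>k (\<tau>::state). mem \<tau> = mem ?\<sigma> \<and> regs \<tau> 4 = 3 * int ?N \<and>
    regs \<tau> 7 = int (g * w) \<and> regs \<tau> 8 = int g \<and> regs \<tau> 9 = 3 * int k)"
  let ?step = "for_loop 10 8
          (Send (Plus (Times (Mod (Load (Plus (Reg 9) (Lit 1))) (Reg 8)) (Reg 8)) (Reg 10))
             [Plus (Times (Load (Reg 9)) (Reg 7)) (Div (Load (Plus (Reg 9) (Lit 1))) (Reg 8)),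
              Load (Plus (Reg 9) (Lit 2))])"
  have step: "wp W S ?step \<tau> (\<lambda>t \<tau>'. t \<le> 6 + 36 * g \<and> I k \<tau>' \<and> sent \<tau>' = sent \<tau> @ scatter_msgs (recs ! k))"
    if I: "I k \<tau>" and k: "k < ?N" for k \<tau>
  proof -
    obtain l i where li: "recs ! k = (l, i)" by fastforce
    then have b: "l < 3" "i < n" using recs[of l i] k nth_mem[OF k] by auto
    note m = mem[OF k li]
    show ?thesis
    proof (rule wp_for_loop[where N = g and B = 28 and I = "\<lambda>d \<tau>'. I k \<tau>' \<and>
          sent \<tau>' = sent \<tau> @ map (\<lambda>d. (int ((i mod g) * g + d), [int (key_address (l, i)), F l i])) [0..<d]"],
        goal_cases)
      case (6 d \<tau>')
      then have r: "mem \<tau>' = mem ?\<sigma>" "regs \<tau>' 7 = int (g * w)" "regs \<tau>' 8 = int g"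
        "regs \<tau>' 9 = 3 * int k" "regs \<tau>' 10 = int d" unfolding I_def by auto
      have "int l * int (g * w) + int i div int g = int (key_address (l, i))"
        unfolding key_address_def by (simp add: zdiv_int)
      moreover have "int i mod int g * int g + int d = int (i mod g * g + d)"
        by (simp add: zmod_int)
      moreover have "\<bar>int (key_address (l, i))\<bar> \<le> W"
        using key_address_less[OF b] by (intro word_small) simp
      ultimately show ?case
        using 6 value_fits_word(1)[OF b] r m unfolding I_def by (simp del: of_nat_mult of_nat_add)
    next
      case (7 t \<tau>')
      then show ?case unfolding li scatter_msgs_def by simp
    qed (use I W_pos word_small[of g] g_le in \<open>auto simp: I_def\<close>)
  qed
  show ?thesis
    unfolding scatter_def wp_Seq
  proof (subst wp_setup_regs, goal_cases)
    case 4
    show ?case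
      unfolding wp_Assign
    proof (intro conjI, goal_cases)
      case 2
      show ?case
      proof (rule wp_For[where N = ?N and B = "10 + 36 * g" and
            I = "\<lambda>k \<tau>. I k \<tau> \<and> sent \<tau> = concat (map scatter_msgs (take k recs))"], goal_cases)
        case (3 k \<tau>)
        then show ?case
          unfolding wp_Seq
        proof (intro wp_mono[OF step[of k \<tau>]], goal_cases)
          case (3 t \<tau>')
          have "\<bar>3 * int k + 3\<bar> \<le> W" using 3 len word_small[of "3 * k + 3"] w_le by simp
          with 3 show ?case by (simp add: I_def take_Suc_conv_app_nth)
        qed auto
      next
        case (5 t \<tau>)
        have "?N * (10 + 36 * g + 1 + 3) \<le> 3 * w * (50 * g)"
          using len g_pos by (intro mult_le_mono) auto
        also have "\<dots> = 150 * (g * w)" by simp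
        finally have "t \<le> 4 + 150 * (g * w)" using 5(1) by simp
        moreover have "1 \<le> g * w" using g_pos w_pos by simp
        ultimately have "14 + (2 + t) \<le> 300 * (g * w)" by linarith
        then show ?case using 5(2) by simp
      qed (auto simp: I_def start_def lws)
    qed (use W_pos in simp)
  qed (auto simp: start_def)
qed

text \<open>Every value is stored at the address named by its key, so the order of arrival does not
  matter.\<close>

lemma wp_load_sample:
  assumes recs: "\<And>l i. (l, i) \<in> set recs \<Longrightarrow> l < 3 \<and> i < n \<and> i mod g = x"
    and len: "length recs \<le> 3 * (g * w)"
    and ws: "ws = concat (map (\<lambda>(l, i). [int (key_address (l, i)), F l i]) recs)"
    and \<sigma>: "mem \<sigma> = mem (start n (g * g) S m ws)" "regs \<sigma> 4 = int (length ws)" "regs \<sigma> 7 = int (g * w)"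
    and Q: "\<And>t \<tau>. t \<le> 60 * (g * w) + 6 \<Longrightarrow>
      (\<And>l i. (l, i) \<in> set recs \<Longrightarrow> mem \<tau> (int (6 * (g * w) + key_address (l, i))) = F l i) \<Longrightarrow>
      (\<And>r. r \<noteq> 9 \<Longrightarrow> regs \<tau> r = regs \<sigma> r) \<Longrightarrow> sent \<tau> = sent \<sigma> \<Longrightarrow> Q t \<tau>"
  shows "wp W S load_sample \<sigma> Q"
proof -
  let ?N = "length recs"
  have lws: "length ws = 2 * ?N"
    unfolding ws by (intro length_concat_uniform) (simp split: prod.split)
  have mem: "mem \<sigma> (2 * int k) = int (key_address (l, i))" "mem \<sigma> (2 * int k + 1) = F l i"
    if "k < ?N" "recs ! k = (l, i)" for k l i
  proof -
    have *: "mem \<sigma> (int (2 * k + r)) = [int (key_address (l, i)), F l i] ! r" if "r < 2" for r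
    proof -
      have "2 * k + r < length ws" using that \<open>k < ?N\<close> unfolding lws by linarith
      then have "mem \<sigma> (int (2 * k + r)) = ws ! (2 * k + r)" unfolding \<sigma> by (rule mem_start)
      also have "\<dots> = (\<lambda>(l, i). [int (key_address (l, i)), F l i]) (recs ! k) ! r"
        unfolding ws using that \<open>k < ?N\<close>
        by (intro nth_concat_uniform) (auto split: prod.split)
      finally show ?thesis unfolding \<open>recs ! k = _\<close> by simp
    qed
    show "mem \<sigma> (2 * int k) = int (key_address (l, i))" "mem \<sigma> (2 * int k + 1) = F l i"
      using *[of 0] *[of 1] by (simp_all add: add.commute)
  qed
  \<comment> \<open>\<open>key_address\<close> forgets \<open>i mod g\<close>, but all records here
    share the residue \<open>x\<close>; hence no sample entry is overwritten.\<close>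
  have inj: "(l, i) = (l', i')" if "(l, i) \<in> set recs" "(l', i') \<in> set recs"
    "key_address (l, i) = key_address (l', i')" for l i l' i'
  proof -
    have b: "i div g < g * w" "i' div g < g * w" "i mod g = x" "i' mod g = x"
      using recs that(1,2) div_less by blast+
    have quot: "(a * s + r) div s = a" if "r < s" for a r s :: nat using that by simp
    have "l = l'" using that(3) quot[OF b(1), of l] quot[OF b(2), of l'] unfolding key_address_def by simp
    moreover from this have "i div g = i' div g" using that(3) unfolding key_address_def by simp
    ultimately show ?thesis using b(3,4) by (metis div_mult_mod_eq)
  qed
  define I where "I = (\<lambda>k (\<tau>::state). regs \<tau> 9 = 2 * int k \<and> (\<forall>r. r \<noteq> 9 \<longrightarrow> regs \<tau> r = regs \<sigma> r) \<and>
    sent \<tau> = sent \<sigma> \<and> (\<forall>a < 6 * (g * w). mem \<tau> (int a) = mem \<sigma> (int a)) \<and>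
    (\<forall>(l, i)\<in>set (take k recs). mem \<tau> (int (6 * (g * w) + key_address (l, i))) = F l i))"
  show ?thesis
    unfolding load_sample_def wp_Seq wp_Assign
  proof (intro conjI, goal_cases)
    case 2
    show ?case
    proof (rule wp_For[where I = I and N = ?N and B = 15], goal_cases)
      case (3 k \<tau>)
      obtain l i where li: "recs ! k = (l, i)" by fastforce
      have mem_li: "(l, i) \<in> set recs" using li 3(1) by (metis nth_mem)
      let ?a = "6 * (g * w) + key_address (l, i)"
      have b: "l < 3" "i < n" using recs[OF mem_li] by auto
      have a: "?a < S" using key_address_less[OF b] g_pos w_pos by simp
      have I: "regs \<tau> 9 = 2 * int k" "regs \<tau> 7 = int (g * w)" "sent \<tau> = sent \<sigma>"
        "\<And>r. r \<noteq> 9 \<Longrightarrow> regs \<tau> r = regs \<sigma> r" "\<And>a. a < 6 * (g * w) \<Longrightarrow> mem \<tau> (int a) = mem \<sigma> (int a)"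
        "\<And>l i. (l, i) \<in> set (take k recs) \<Longrightarrow> mem \<tau> (int (6 * (g * w) + key_address (l, i))) = F l i"
        using 3(2) \<sigma>(3) unfolding I_def by auto
      have m: "mem \<tau> (2 * int k) = int (key_address (l, i))" "mem \<tau> (2 * int k + 1) = F l i"
        using I(5)[of "2 * k"] I(5)[of "2 * k + 1"] mem[OF 3(1) li] 3(1) len
        by (simp_all add: add.commute)
      have ea: "6 * int (g * w) + int (key_address (l, i)) = int ?a" by simp
      have a': "6 * int (g * w) + int (key_address (l, i)) < int S" unfolding ea using a by linarith
      let ?\<tau> = "\<tau>\<lparr>mem := (mem \<tau>)(int ?a := F l i), regs := (regs \<tau>)(9 := 2 * int k + 2)\<rparr>"
      have "I (Suc k) ?\<tau>"
        unfolding I_def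
      proof (intro conjI)
        show "\<forall>(l, i)\<in>set (take (Suc k) recs). mem ?\<tau> (int (6 * (g * w) + key_address (l, i))) = F l i"
        proof safe
          fix l' i'
          assume "(l', i') \<in> set (take (Suc k) recs)"
          then consider "(l', i') = (l, i)" | "(l', i') \<in> set (take k recs)" "(l', i') \<noteq> (l, i)"
            using li 3(1) by (auto simp: take_Suc_conv_app_nth)
          then show "mem ?\<tau> (int (6 * (g * w) + key_address (l', i'))) = F l' i'"
          proof cases
            case 2
            then have "key_address (l', i') \<noteq> key_address (l, i)"
              using inj[OF _ mem_li] by (meson in_set_takeD)
            then show ?thesis using I(6)[OF 2(1)] by simp
          qed simp
        qed
        \<comment> \<open>The inbox occupies addresses below \<open>6 * (g * w)\<close> only, so the
          records still to be read stay intact.\<close>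
        show "\<forall>a<6 * (g * w). mem ?\<tau> (int a) = mem \<sigma> (int a)"
        proof (intro allI impI)
          fix a
          assume "a < 6 * (g * w)"
          then have "int a \<noteq> int ?a" "mem \<tau> (int a) = mem \<sigma> (int a)"
            using I(5) by (simp_all only: of_nat_eq_iff)
          then show "mem ?\<tau> (int a) = mem \<sigma> (int a)"
            by (simp del: of_nat_add of_nat_mult)
        qed
      qed (use I in simp_all)
      then have "I (Suc k) (\<tau>\<lparr>mem := (mem \<tau>)(6 * int (g * w) + int (key_address (l, i)) := F l i),
          regs := (regs \<tau>)(9 := 2 * int k + 2)\<rparr>)"
        unfolding ea .
      moreover have "\<bar>2 * int k + 2\<bar> \<le> W"
        using 3(1) len word_small[of "2 * k + 2"] g_pos w_pos by simp
      ultimately show ?case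
        using value_fits_word(1)[OF b] I(1,2) m a' by (simp del: of_nat_mult)
    next
      case (4 \<tau>)
      then show ?case using \<sigma>(2) lws unfolding I_def by simp
    next
      case (5 t \<tau>)
      have "?N * 19 \<le> 3 * (g * w) * 19" using len by (intro mult_le_mono) auto
      then have "2 + t \<le> 60 * (g * w) + 6" using 5(1) by simp
      then show ?case using 5(2) unfolding I_def by (intro Q) auto
    qed (use \<sigma>(2) lws in \<open>auto simp: I_def\<close>)
  qed (use W_pos in simp)
qed


text \<open>
  Truncated subtraction is harmless here: \<open>i * w - 1\<close> and the like are used for positive block
  numbers only.  Empty blocks have to be excluded explicitly, since no sample point bounds them.
\<close>

definition relevant :: "nat \<Rightarrow> nat \<Rightarrow> nat \<Rightarrow> nat \<Rightarrow> bool" where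
  "relevant x i j k \<longleftrightarrow>
     (i * w * g < n \<and> j * w * g < n \<and> k * w * g < n) \<and>
     \<not> (0 < i \<and> 0 < j \<and> (k + 1) * w * g + x < n \<and>
        F 2 ((k + 1) * w * g + x) < F 0 ((i * w - 1) * g + x) + F 1 ((j * w - 1) * g + x)) \<and>
     \<not> (0 < k \<and> (i + 1) * w * g + x < n \<and> (j + 1) * w * g + x < n \<and>
        F 0 ((i + 1) * w * g + x) + F 1 ((j + 1) * w * g + x) < F 2 ((k * w - 1) * g + x))"

section \<open>Second round: testing block triples and sending them\<close>

definition pick :: "nat \<Rightarrow> nat \<Rightarrow> nat \<Rightarrow> nat \<Rightarrow> int list" where
  "pick x l b u = (if (b * w + u) * g + x < n then [3 * F l ((b * w + u) * g + x) + int l] else [])"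

definition block_words :: "nat \<Rightarrow> nat \<Rightarrow> nat \<Rightarrow> nat \<Rightarrow> int list" where
  "block_words x i j k = concat (map (\<lambda>u. pick x 0 i u @ pick x 1 j u @ pick x 2 k u) [0..<w])"

text \<open>Difference modulo \<open>g\<close>; adding \<open>g\<close> first keeps the subtraction
  on naturals exact for \<open>b < g\<close>.\<close>

definition cyc_diff :: "nat \<Rightarrow> nat \<Rightarrow> nat" where
  "cyc_diff a b = (a + g - b) mod g"

definition match_msgs :: "nat \<Rightarrow> nat \<Rightarrow> nat \<Rightarrow> nat \<Rightarrow> (int \<times> int list) list" where
  "match_msgs x d q i =
     (if relevant x i (cyc_diff i d) (cyc_diff q i)
      then map (\<lambda>v. (int (d * g + q), [v])) (block_words x i (cyc_diff i d) (cyc_diff q i)) else [])"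

definition sampled :: "nat \<Rightarrow> nat \<Rightarrow> state \<Rightarrow> bool" where
  "sampled x d \<tau> \<longleftrightarrow>
     regs \<tau> 0 = int n \<and> regs \<tau> 6 = int w \<and> regs \<tau> 7 = int (g * w) \<and> regs \<tau> 8 = int g \<and>
     regs \<tau> 9 = int x \<and> regs \<tau> 10 = int d \<and>
     (\<forall>l t. l < 3 \<longrightarrow> t * g + x < n \<longrightarrow> mem \<tau> (int (6 * (g * w) + l * (g * w) + t)) = F l (t * g + x))"

lemma sampledD:
  assumes "sampled x d \<tau>"
  shows "regs \<tau> 0 = int n" "regs \<tau> 6 = int w" "regs \<tau> 7 = int (g * w)" "regs \<tau> 8 = int g"
    "regs \<tau> 9 = int x" "regs \<tau> 10 = int d"
    "l < 3 \<Longrightarrow> t * g + x < n \<Longrightarrow> mem \<tau> (int (6 * (g * w) + l * (g * w) + t)) = F l (t * g + x)"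
  using assms unfolding sampled_def by auto

text \<open>The loops of \<open>match_blocks\<close> use registers above 10 only, so they preserve
  \<open>sampled\<close> by this rule.\<close>

lemma sampled_cong:
  assumes "sampled x d \<tau>" "\<And>r. r \<le> 10 \<Longrightarrow> regs \<tau>' r = regs \<tau> r" "mem \<tau>' = mem \<tau>"
  shows "sampled x d \<tau>'"
  using assms unfolding sampled_def by simp

lemma eval_in_sample:
  assumes "sampled x d \<tau>" "eval e \<tau> = int t"
  shows "eval (in_sample e) \<tau> \<noteq> 0 \<longleftrightarrow> t * g + x < n"
proof -
  have "int t * int g + int x < int n \<longleftrightarrow> t * g + x < n"
    by (metis of_nat_add of_nat_less_iff of_nat_mult)
  then show ?thesis
    unfolding in_sample_def eval_Less_nonzero using sampledD[OF assms(1)] assms(2) by simp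
qed

lemma eval_sample_at:
  assumes "sampled x d \<tau>" "eval e \<tau> = int t" "l < 3" "t * g + x < n"
  shows "eval (sample_at l e) \<tau> = F l (t * g + x)"
proof -
  have "(6 + int l) * int (g * w) + int t = int (6 * (g * w) + l * (g * w) + t)"
    by (simp add: algebra_simps)
  then show ?thesis
    unfolding sample_at_def using sampledD[OF assms(1)] assms(2-4) by (simp del: of_nat_add of_nat_mult)
qed

text \<open>This is why the tests check the range only of entries after a block: since
  \<open>x < g\<close>, the entry before a nonempty block lies below the start of that
  block.\<close>

lemma before_block_less:
  assumes "x < g" "0 < b" "b * w * g < n"
  shows "(b * w - 1) * g + x < n"
proof -
  obtain c where "b * w = Suc c" using assms(2) w_pos by (metis Suc_pred nat_0_less_mult_iff)
  then show ?thesis using assms by simp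
qed

lemma eval_relevant:
  assumes s: "sampled x d \<tau>" and x: "x < g"
    and r: "regs \<tau> 12 = int i" "regs \<tau> 13 = int j" "regs \<tau> 14 = int k"
  shows "eval relevant_expr \<tau> \<noteq> 0 \<longleftrightarrow> relevant x i j k"
proof -
  have nonempty: "eval (nonempty_block c) \<tau> \<noteq> 0 \<longleftrightarrow> b * w * g < n" if "regs \<tau> c = int b" for b c
    unfolding nonempty_block_def eval_Less_nonzero
    using that sampledD[OF s] by (simp flip: of_nat_mult)
  have after: "eval (after_block c) \<tau> = int ((b + 1) * w)" if "regs \<tau> c = int b" for b c
    unfolding after_block_def using that sampledD[OF s] by (simp add: algebra_simps)
  have before: "eval (before_block c) \<tau> = int (b * w - 1)" if "regs \<tau> c = int b" "0 < b" for b c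
    unfolding before_block_def using that sampledD[OF s] w_pos by (simp add: of_nat_diff Suc_le_eq)
  have big: "eval too_big \<tau> \<noteq> 0 \<longleftrightarrow> 0 < i \<and> 0 < j \<and> (k + 1) * w * g + x < n \<and>
      F 2 ((k + 1) * w * g + x) < F 0 ((i * w - 1) * g + x) + F 1 ((j * w - 1) * g + x)"
    if "i * w * g < n" "j * w * g < n"
  proof (cases "0 < i \<and> 0 < j \<and> (k + 1) * w * g + x < n")
    case True
    then show ?thesis
      using eval_sample_at[OF s after[OF r(3)], of 2] eval_sample_at[OF s before[OF r(1)], of 0]
        eval_sample_at[OF s before[OF r(2)], of 1] before_block_less[OF x] that
      unfolding too_big_def eval_Times_nonzero eval_Less_nonzero
        eval_in_sample[OF s after[OF r(3)]] using r by simp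
  next
    case False
    then show ?thesis
      unfolding too_big_def eval_Times_nonzero eval_Less_nonzero
        eval_in_sample[OF s after[OF r(3)]] using r by auto
  qed
  have small: "eval too_small \<tau> \<noteq> 0 \<longleftrightarrow>
      0 < k \<and> (i + 1) * w * g + x < n \<and> (j + 1) * w * g + x < n \<and>
      F 0 ((i + 1) * w * g + x) + F 1 ((j + 1) * w * g + x) < F 2 ((k * w - 1) * g + x)"
    if "k * w * g < n"
  proof (cases "0 < k \<and> (i + 1) * w * g + x < n \<and> (j + 1) * w * g + x < n")
    case True
    then show ?thesis
      using eval_sample_at[OF s after[OF r(1)], of 0] eval_sample_at[OF s after[OF r(2)], of 1]
        eval_sample_at[OF s before[OF r(3)], of 2] before_block_less[OF x] that
      unfolding too_small_def eval_Times_nonzero eval_Less_nonzero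
        eval_in_sample[OF s after[OF r(1)]] eval_in_sample[OF s after[OF r(2)]] using r by simp
  next
    case False
    then show ?thesis
      unfolding too_small_def eval_Times_nonzero eval_Less_nonzero
        eval_in_sample[OF s after[OF r(1)]] eval_in_sample[OF s after[OF r(2)]] using r by auto
  qed
  show ?thesis
    unfolding relevant_expr_def relevant_def eval_Times_nonzero eval_Equal_nonzero
      nonempty[OF r(1)] nonempty[OF r(2)] nonempty[OF r(3)]
    using big small by blast
qed

lemma wp_send_element:
  assumes s: "sampled x d \<tau>" and r: "regs \<tau> 11 = int q" "regs \<tau> c = int b" "regs \<tau> 15 = int u"
    and l: "l < 3"
    and Q: "\<And>t. t \<le> 60 \<Longrightarrow>
      Q t (\<tau>\<lparr>sent := sent \<tau> @ map (\<lambda>v. (int (d * g + q), [v])) (pick x l b u)\<rparr>)"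
  shows "wp W S (send_element l c) \<tau> Q"
proof -
  let ?e = "Plus (Times (Reg c) (Reg 6)) (Reg 15)"
  have e: "eval ?e \<tau> = int (b * w + u)" using sampledD[OF s] r by simp
  show ?thesis
  proof (cases "(b * w + u) * g + x < n")
    case True
    with eval_in_sample[OF s e] have c: "eval (in_sample ?e) \<tau> \<noteq> 0" by blast
    have "eval (sample_at l ?e) \<tau> = F l ((b * w + u) * g + x)"
      using eval_sample_at[OF s e l True] .
    moreover have "eval (Plus (Times (Reg 10) (Reg 8)) (Reg 11)) \<tau> = int (d * g + q)"
      using sampledD[OF s] r by simp
    moreover have "Q (1 + cost (in_sample ?e) + (1 + cost (Plus (Times (Reg 10) (Reg 8)) (Reg 11)) +
        sum_list (map cost [Plus (Times (Lit 3) (sample_at l ?e)) (Lit (int l))])))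
      (\<tau>\<lparr>sent := sent \<tau> @ map (\<lambda>v. (int (d * g + q), [v])) (pick x l b u)\<rparr>)"
      by (rule Q) (simp add: in_sample_def sample_at_def)
    ultimately show ?thesis
      unfolding send_element_def wp_If if_P[OF c] wp_Send
      using value_fits_word(2)[OF l True] True by (simp add: pick_def)
  next
    case False
    then have c: "\<not> eval (in_sample ?e) \<tau> \<noteq> 0" using eval_in_sample[OF s e] by blast
    show ?thesis
      unfolding send_element_def wp_If if_not_P[OF c] wp_Skip
      using Q[of "1 + cost (in_sample ?e) + 1"] False by (simp add: pick_def in_sample_def)
  qed
qed

lemma wp_send_blocks:
  assumes s: "sampled x d \<tau>" and r: "regs \<tau> 11 = int q" "regs \<tau> 12 = int i" "regs \<tau> 13 = int j"
      "regs \<tau> 14 = int k"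
    and Q: "\<And>t \<tau>'. t \<le> 6 + 188 * w \<Longrightarrow> sampled x d \<tau>' \<Longrightarrow> regs \<tau>' 11 = int q \<Longrightarrow> regs \<tau>' 12 = int i \<Longrightarrow>
      sent \<tau>' = sent \<tau> @ map (\<lambda>v. (int (d * g + q), [v])) (block_words x i j k) \<Longrightarrow> Q t \<tau>'"
  shows "wp W S (for_loop 15 6 (send_element 0 12 ;; send_element 1 13 ;; send_element 2 14)) \<tau> Q"
proof -
  define I where "I = (\<lambda>u (\<tau>'::state). sampled x d \<tau>' \<and> regs \<tau>' 11 = int q \<and> regs \<tau>' 12 = int i \<and>
    regs \<tau>' 13 = int j \<and> regs \<tau>' 14 = int k \<and> sent \<tau>' = sent \<tau> @ map (\<lambda>v. (int (d * g + q), [v]))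
      (concat (map (\<lambda>u. pick x 0 i u @ pick x 1 j u @ pick x 2 k u) [0..<u])))"
  show ?thesis
  proof (rule wp_for_loop[where N = w and I = I and B = 180], goal_cases)
    case (6 u \<tau>')
    then have I: "sampled x d \<tau>'" "regs \<tau>' 11 = int q" "regs \<tau>' 12 = int i"
      "regs \<tau>' 13 = int j" "regs \<tau>' 14 = int k" "sent \<tau>' = sent \<tau> @ map (\<lambda>v. (int (d * g + q), [v]))
      (concat (map (\<lambda>u. pick x 0 i u @ pick x 1 j u @ pick x 2 k u) [0..<u]))"
      unfolding I_def by auto
    show ?case
      unfolding wp_Seq
    proof (rule wp_send_element[where x = x and d = d and q = q and b = i and u = u], goal_cases)
      case (6 t1)
      show ?case
      proof (rule wp_send_element[where x = x and d = d and q = q and b = j and u = u], goal_cases)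
        case (6 t2)
        show ?case
          by (rule wp_send_element[where x = x and d = d and q = q and b = k and u = u])
            (use I 6 \<open>t1 \<le> 60\<close> \<open>regs \<tau>' 15 = int u\<close> in \<open>simp_all add: sampledD(2)[OF I(1)] sampled_cong[OF I(1)] I_def\<close>)
      qed (use I \<open>regs \<tau>' 15 = int u\<close> in \<open>simp_all add: sampled_cong[OF I(1)]\<close>)
    qed (use I \<open>regs \<tau>' 15 = int u\<close> in simp_all)
  next
    case (7 t \<tau>')
    then show ?case unfolding I_def by (intro Q) (simp_all add: block_words_def)
  qed (use s r W_pos words_le sampledD[OF s] in \<open>simp_all add: I_def sampled_cong[OF s]\<close>)
qed

lemma cyc_diff_less: "cyc_diff a b < g"
  using g_pos by (simp add: cyc_diff_def)

lemma int_cyc_diff: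
  assumes "b < g"
  shows "(int a - int b) mod int g = int (cyc_diff a b)"
proof -
  have "int (cyc_diff a b) = (int a - int b + int g) mod int g"
    unfolding cyc_diff_def using assms by (simp add: zmod_int of_nat_diff algebra_simps)
  then show ?thesis by simp
qed


text \<open>Every pair \<open>(q, i)\<close> is charged the full cost of sending a triple. This
  gives a multiple of \<open>g * g * w\<close>, and all terms that occur are bounded by the square
  of \<open>g * w\<close>.\<close>

lemma wp_match_blocks:
  assumes recs: "set recs = {(l, i). l < 3 \<and> i < n \<and> i mod g = m div g}"
    and len: "length recs \<le> 3 * (g * w)" and m: "m < g * g"
    and ws: "ws = concat (map (\<lambda>(l, i). [int (key_address (l, i)), F l i]) recs)"
  shows "wp W S match_blocks (start n (g * g) S m ws) (\<lambda>t \<tau>. t \<le> 600 * (g * w)\<^sup>2 \<and>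
    sent \<tau> = concat (map (\<lambda>q. concat (map (match_msgs (m div g) (m mod g) q) [0..<g])) [0..<g]))"
proof -
  let ?\<sigma> = "start n (g * g) S m ws"
  let ?x = "m div g" and ?d = "m mod g"
  have xd: "?x < g" "?d < g" using m g_pos by (simp_all add: less_mult_imp_div_less)
  define msgs where "msgs = (\<lambda>q. concat (map (match_msgs ?x ?d q) [0..<g]))"
  let ?body = "Assign 13 (Mod (Minus (Reg 12) (Reg 10)) (Reg 8)) ;;
        Assign 14 (Mod (Minus (Reg 11) (Reg 12)) (Reg 8)) ;;
        If relevant_expr
          (for_loop 15 6 (send_element 0 12 ;; send_element 1 13 ;; send_element 2 14))
          Skip"
  have body: "wp W S ?body \<tau> (\<lambda>t \<tau>'. t \<le> 200 + 188 * w \<and> sampled ?x ?d \<tau>' \<and>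
      regs \<tau>' 11 = int q \<and> regs \<tau>' 12 = int i \<and> sent \<tau>' = sent \<tau> @ match_msgs ?x ?d q i)"
    if s: "sampled ?x ?d \<tau>" and r: "regs \<tau> 11 = int q" "regs \<tau> 12 = int i" and i: "i < g" for q i \<tau>
  proof -
    let ?j = "cyc_diff i ?d" and ?k = "cyc_diff q i"
    let ?\<tau> = "\<tau>\<lparr>regs := (regs \<tau>)(13 := int ?j, 14 := int ?k)\<rparr>"
    have s': "sampled ?x ?d ?\<tau>" by (rule sampled_cong[OF s]) simp_all
    have r': "regs ?\<tau> 11 = int q" "regs ?\<tau> 12 = int i" "regs ?\<tau> 13 = int ?j" "regs ?\<tau> 14 = int ?k"
      using r by simp_all
    have if': "wp W S (If relevant_expr
          (for_loop 15 6 (send_element 0 12 ;; send_element 1 13 ;; send_element 2 14))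
          Skip) ?\<tau> (\<lambda>t \<tau>'. t \<le> 150 + 188 * w \<and> sampled ?x ?d \<tau>' \<and>
      regs \<tau>' 11 = int q \<and> regs \<tau>' 12 = int i \<and> sent \<tau>' = sent \<tau> @ match_msgs ?x ?d q i)"
    proof (cases "relevant ?x i ?j ?k")
      case True
      have c: "eval relevant_expr ?\<tau> \<noteq> 0"
        using True eval_relevant[OF s' xd(1) r'(2-4)] by blast
      show ?thesis
        unfolding wp_If if_P[OF c]
        by (rule wp_send_blocks[OF s' r'])
          (simp_all add: match_msgs_def True relevant_expr_def too_big_def too_small_def nonempty_block_def
            in_sample_def sample_at_def before_block_def after_block_def)
    next
      case False
      have c: "\<not> eval relevant_expr ?\<tau> \<noteq> 0"
        using False eval_relevant[OF s' xd(1) r'(2-4)] by blast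
      show ?thesis
        unfolding wp_If if_not_P[OF c] wp_Skip
        using s' r' False by (simp add: match_msgs_def relevant_expr_def too_big_def too_small_def nonempty_block_def
            in_sample_def sample_at_def before_block_def after_block_def)
    qed
    have e1: "eval (Mod (Minus (Reg 12) (Reg 10)) (Reg 8)) \<tau> = int ?j"
      using r sampledD[OF s] int_cyc_diff[OF xd(2), of i] by simp
    have e2: "eval (Mod (Minus (Reg 11) (Reg 12)) (Reg 8)) (\<tau>\<lparr>regs := (regs \<tau>)(13 := int ?j)\<rparr>) = int ?k"
      using r sampledD[OF s] int_cyc_diff[OF i, of q] by simp
    have W: "\<bar>int ?j\<bar> \<le> W" "\<bar>int ?k\<bar> \<le> W"
      using cyc_diff_less[of i ?d] cyc_diff_less[of q i] words_le(1) by linarith+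
    have eq: "\<tau>\<lparr>regs := (regs \<tau>)(13 := int ?j)\<rparr>\<lparr>regs :=
      (regs (\<tau>\<lparr>regs := (regs \<tau>)(13 := int ?j)\<rparr>))(14 := int ?k)\<rparr> = ?\<tau>"
      by simp
    show ?thesis
      unfolding wp_Seq wp_Assign e1 e2 eq using W
      by (intro conjI wp_mono[OF if']) auto
  qed
  have row: "wp W S (for_loop 12 8 ?body) \<tau> (\<lambda>t \<tau>'. t \<le> 6 + g * (208 + 188 * w) \<and>
      sampled ?x ?d \<tau>' \<and> regs \<tau>' 11 = int q \<and> sent \<tau>' = sent \<tau> @ msgs q)"
    if s: "sampled ?x ?d \<tau>" and r: "regs \<tau> 11 = int q" for q \<tau>
  proof (rule wp_for_loop[where N = g and B = "200 + 188 * w" and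
        I = "\<lambda>i \<tau>'. sampled ?x ?d \<tau>' \<and> regs \<tau>' 11 = int q \<and>
          sent \<tau>' = sent \<tau> @ concat (map (match_msgs ?x ?d q) [0..<i])"], goal_cases)
    case 5
    then show ?case using r sampled_cong[OF s] by simp
  next
    case (6 i \<tau>')
    then have I: "sampled ?x ?d \<tau>'" "regs \<tau>' 11 = int q"
      "sent \<tau>' = sent \<tau> @ concat (map (match_msgs ?x ?d q) [0..<i])" by auto
    show ?case
    proof (rule wp_mono[OF body[OF I(1,2) 6(3,1)]], elim conjE, intro conjI, goal_cases)
      case (3 t \<tau>'')
      then show ?case by (intro sampledD(4)[of ?x ?d])
    next
      case (4 t \<tau>'')
      then show ?case by - (rule sampled_cong[of ?x ?d \<tau>''], simp_all)
    qed (simp_all add: I(3))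
  qed (use W_pos words_le(1) sampledD(4)[OF s] in \<open>simp_all add: msgs_def\<close>)
  show ?thesis
    unfolding match_blocks_def wp_Seq
  proof (subst wp_setup_regs, goal_cases)
    case 4
    let ?\<tau> = "?\<sigma>\<lparr>regs := (regs ?\<sigma>)(6 := int w, 7 := int (g * w), 8 := int g)\<rparr>"
    show ?case
    proof (rule wp_load_sample[where x = ?x and recs = recs and ws = ws], goal_cases)
      case (7 t0 \<tau>0)
      have r0: "regs \<tau>0 r = regs ?\<tau> r" if "r \<noteq> 9" for r using 7(3) that .
      have e: "int m div int g = int ?x" "int m mod int g = int ?d" by (simp_all add: zdiv_int zmod_int)
      have reg: "regs \<tau>0 3 = int m" "regs \<tau>0 8 = int g" "regs \<tau>0 0 = int n" "regs \<tau>0 6 = int w"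
        "regs \<tau>0 7 = int (g * w)"
        unfolding r0[of 3, simplified] r0[of 8, simplified] r0[of 0, simplified] r0[of 6, simplified]
          r0[of 7, simplified] by (simp_all add: start_def)
      have sent0: "sent \<tau>0 = []" using 7(4) by (simp add: start_def)
      let ?\<tau>1 = "\<tau>0\<lparr>regs := (regs \<tau>0)(9 := int ?x, 10 := int ?d)\<rparr>"
      have mem: "mem \<tau>0 (int (6 * (g * w) + l * (g * w) + t)) = F l (t * g + ?x)"
        if "l < 3" "t * g + ?x < n" for l t
      proof -
        have "(l, t * g + ?x) \<in> set recs" using that xd(1) unfolding recs by simp
        moreover have "key_address (l, t * g + ?x) = l * (g * w) + t"
          unfolding key_address_def using xd(1) by simp
        ultimately show ?thesis using 7(2) by (metis add.assoc)
      qed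
      have s1: "sampled ?x ?d ?\<tau>1"
        unfolding sampled_def using reg mem by simp
      have W: "\<bar>int ?x\<bar> \<le> W" "\<bar>int ?d\<bar> \<le> W" using xd words_le(1) by linarith+
      have loop: "wp W S (for_loop 11 8 (for_loop 12 8 ?body)) ?\<tau>1
        (\<lambda>t \<tau>. t \<le> 6 + g * (6 + g * (208 + 188 * w) + 8) \<and> sent \<tau> = concat (map msgs [0..<g]))"
      proof (rule wp_for_loop[where N = g and B = "6 + g * (208 + 188 * w)" and
            I = "\<lambda>q \<tau>'. sampled ?x ?d \<tau>' \<and> sent \<tau>' = concat (map msgs [0..<q])"], goal_cases)
        case 5
        then show ?case using sent0 sampled_cong[OF s1] by simp
      next
        case (6 q \<tau>')
        then have I: "sampled ?x ?d \<tau>'" "sent \<tau>' = concat (map msgs [0..<q])" by auto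
        show ?case
        proof (rule wp_mono[OF row[OF I(1) 6(3)]], elim conjE, intro conjI, goal_cases)
          case (3 t \<tau>'')
          then show ?case by (intro sampledD(4)[of ?x ?d])
        next
          case (4 t \<tau>'')
          then show ?case by - (rule sampled_cong[of ?x ?d \<tau>''], simp_all)
        qed (simp_all add: I(2))
      qed (use W_pos words_le(1) reg(2) in simp_all)
      have time: "14 + (t0 + (4 + (4 + t))) \<le> 600 * (g * w)\<^sup>2" if "t \<le> 6 + g * (6 + g * (208 + 188 * w) + 8)" for t
      proof -
        define a where "a = (g * w)\<^sup>2"
        have "g * w * 1 \<le> g * w * (g * w)" "g * 1 * (1 * 1) \<le> g * w * (g * w)" "g * 1 * (g * 1) \<le> g * w * (g * w)"
          "g * 1 * (g * w) \<le> g * w * (g * w)" "1 * 1 * (1 * 1) \<le> g * w * (g * w)"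
          using g_pos w_pos by (intro mult_le_mono; simp)+
        then have "g * w \<le> a" "g \<le> a" "g * g \<le> a" "g * (g * w) \<le> a" "1 \<le> a"
          unfolding a_def power2_eq_square by simp_all
        moreover have "t0 \<le> 60 * (g * w) + 6" by (rule 7(1))
        moreover have "t \<le> 6 + 14 * g + 208 * (g * g) + 188 * (g * (g * w))"
          using that by (simp add: algebra_simps)
        ultimately show ?thesis unfolding a_def[symmetric] by linarith
      qed
      have eq: "\<tau>0\<lparr>regs := (regs \<tau>0)(9 := int ?x)\<rparr>\<lparr>regs :=
        (regs (\<tau>0\<lparr>regs := (regs \<tau>0)(9 := int ?x)\<rparr>))(10 := int ?d)\<rparr> = ?\<tau>1"
        by simp
      have e1: "eval (Div (Reg 3) (Reg 8)) \<tau>0 = int ?x" using reg e by simp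
      have e2: "eval (Mod (Reg 3) (Reg 8)) (\<tau>0\<lparr>regs := (regs \<tau>0)(9 := int ?x)\<rparr>) = int ?d"
        using reg e by simp
      show ?case
        unfolding wp_Seq wp_Assign e1 e2 eq
      proof (intro conjI W wp_mono[OF loop], elim conjE, goal_cases)
        case (1 t \<tau>)
        then show ?case using time[of t] by simp
      next
        case (2 t \<tau>)
        then show ?case unfolding msgs_def by simp
      qed
    next
      case (1 l i)
      then show ?case unfolding recs by simp
    qed (use len ws in \<open>simp_all add: start_def\<close>)
  qed (simp_all add: start_def)
qed

end

section \<open>Which block triples survive\<close>

text \<open>All elements lie among the three consecutive numbers starting at the least one.\<close>

lemma card_le_3_if_close:
  fixes A :: "nat set"
  assumes "\<And>i i'. i \<in> A \<Longrightarrow> i' \<in> A \<Longrightarrow> i' < i + 3"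
  shows "card A \<le> 3"
proof (cases "A = {}")
  case False
  then have "(LEAST i. i \<in> A) \<in> A" by (metis LeastI ex_in_conv)
  then have "A \<subseteq> {(LEAST i. i \<in> A)..<(LEAST i. i \<in> A) + 3}"
    using assms Least_le by fastforce
  then have "card A \<le> card {(LEAST i. i \<in> A)..<(LEAST i. i \<in> A) + 3}"
    by (rule card_mono[rotated]) simp
  then show ?thesis by simp
qed simp

lemma length_concat_filter_le:
  assumes "\<And>x. length (f x) \<le> c"
  shows "length (concat (map (\<lambda>x. if P x then f x else []) xs)) \<le> c * length (filter P xs)"
proof (induction xs)
  case (Cons x xs)
  then show ?case using assms[of x] by auto
qed simp

context grid
begin

lemma F_mono: "l < 3 \<Longrightarrow> a \<le> b \<Longrightarrow> b < n \<Longrightarrow> F l a \<le> F l b"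
  using increasing[of l a b] by (cases "a = b") auto

text \<open>Source of the distance 3: at distance 2 the entry after block \<open>a\<close> and the
  entry before block \<open>b\<close> coincide if \<open>w = 1\<close>, and the comparison has to be
  strict.\<close>

lemma after_before_block:
  assumes "x < g" "a + 3 \<le> b" "b * w * g < n"
  shows "(a + 1) * w * g + x < (b * w - 1) * g + x" "(b * w - 1) * g + x < n"
proof -
  show "(b * w - 1) * g + x < n" using assms by (intro before_block_less) auto
  have "(a + 3) * w \<le> b * w" using assms(2) by (rule mult_le_mono1)
  then have "(a + 1) * w < b * w - 1" using w_pos by (simp add: algebra_simps)
  then show "(a + 1) * w * g + x < (b * w - 1) * g + x" using g_pos by simp
qed

text \<open>
  Along a diagonal the intervals of sums move up with \<open>i\<close>, so block triples that survive the test
  cannot move up in \<open>A\<close> and \<open>B\<close> while moving down in \<open>C\<close>.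
\<close>

lemma relevant_chain:
  assumes "relevant x i j k" "relevant x i' j' k'" "x < g" "i + 3 \<le> i'" "j + 3 \<le> j'" "k' + 3 \<le> k"
  shows False
proof -
  note r = assms(1)[unfolded relevant_def] assms(2)[unfolded relevant_def]
  have a: "(i + 1) * w * g + x < (i' * w - 1) * g + x" "(i' * w - 1) * g + x < n"
    using after_before_block[OF assms(3,4)] r by blast+
  have b: "(j + 1) * w * g + x < (j' * w - 1) * g + x" "(j' * w - 1) * g + x < n"
    using after_before_block[OF assms(3,5)] r by blast+
  have c: "(k' + 1) * w * g + x < (k * w - 1) * g + x" "(k * w - 1) * g + x < n"
    using after_before_block[OF assms(3,6)] r by blast+
  have "F 0 ((i' * w - 1) * g + x) + F 1 ((j' * w - 1) * g + x) \<le> F 2 ((k' + 1) * w * g + x)"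
  proof -
    \<comment> \<open>The entry after block \<open>k'\<close> is in range since it precedes the
      entry before block \<open>k\<close>; so the first test of the primed triple, which it
      survived, yields the inequality. The second test is used for the unprimed triple in the same
      way.\<close>
    have "0 < i'" "0 < j'" "(k' + 1) * w * g + x < n" using assms(4,5) c by linarith+
    then show ?thesis using r(2) by (metis not_le)
  qed
  moreover have "F 2 ((k * w - 1) * g + x) \<le> F 0 ((i + 1) * w * g + x) + F 1 ((j + 1) * w * g + x)"
  proof -
    have "0 < k" "(i + 1) * w * g + x < n" "(j + 1) * w * g + x < n" using assms(6) a b by linarith+
    then show ?thesis using r(1) by (metis not_le)
  qed
  moreover have "F 0 ((i + 1) * w * g + x) < F 0 ((i' * w - 1) * g + x)"
    "F 1 ((j + 1) * w * g + x) < F 1 ((j' * w - 1) * g + x)"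
    "F 2 ((k' + 1) * w * g + x) < F 2 ((k * w - 1) * g + x)"
    using increasing[of 0, OF _ a] increasing[of 1, OF _ b] increasing[of 2, OF _ c] by simp_all
  ultimately show False by linarith
qed

lemma cyc_diff_eq: "a < g \<Longrightarrow> b < g \<Longrightarrow> cyc_diff a b = (if b \<le> a then a - b else a + g - b)"
  unfolding cyc_diff_def by (auto simp: mod_if)

text \<open>The four classes record whether \<open>i - d\<close> and \<open>q - i\<close> wrap
  around. Within a class a step of at least 3 in \<open>i\<close> raises \<open>j\<close> and lowers
  \<open>k\<close> by the same amount, which \<open>relevant_chain\<close> forbids; so each class
  has at most 3 members.\<close>

lemma card_relevant:
  assumes "x < g" "d < g" "q < g"
  shows "card {i. i < g \<and> relevant x i (cyc_diff i d) (cyc_diff q i)} \<le> 12"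
proof -
  define G where "G = (\<lambda>u v. {i. i < g \<and> relevant x i (cyc_diff i d) (cyc_diff q i) \<and>
    (d \<le> i \<longleftrightarrow> u) \<and> (i \<le> q \<longleftrightarrow> v)})"
  have G: "card (G u v) \<le> 3" for u v
  proof (rule card_le_3_if_close, rule ccontr)
    fix i i'
    assume i: "i \<in> G u v" "i' \<in> G u v" and "\<not> i' < i + 3"
    then have ii: "i + 3 \<le> i'" "i < g" "i' < g" "d \<le> i \<longleftrightarrow> d \<le> i'" "i \<le> q \<longleftrightarrow> i' \<le> q"
      "relevant x i (cyc_diff i d) (cyc_diff q i)" "relevant x i' (cyc_diff i' d) (cyc_diff q i')"
      unfolding G_def by auto
    have "cyc_diff i d + 3 \<le> cyc_diff i' d" "cyc_diff q i' + 3 \<le> cyc_diff q i"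
      using ii(1-5) assms by (auto simp: cyc_diff_eq)
    with relevant_chain[OF ii(6,7) assms(1) ii(1)] show False by blast
  qed
  have eq: "{i. i < g \<and> relevant x i (cyc_diff i d) (cyc_diff q i)} =
      (G True True \<union> G True False) \<union> (G False True \<union> G False False)"
    unfolding G_def by blast
  show ?thesis
    unfolding eq
    using card_Un_le[of "G True True \<union> G True False" "G False True \<union> G False False"]
      card_Un_le[of "G True True" "G True False"] card_Un_le[of "G False True" "G False False"]
      G[of True True] G[of True False] G[of False True] G[of False False]
    by linarith
qed

section \<open>What one sample contributes to one machine: size, soundness, completeness\<close>

definition row_words :: "nat \<Rightarrow> nat \<Rightarrow> nat \<Rightarrow> int list" where
  "row_words x d q = concat (map (\<lambda>i. if relevant x i (cyc_diff i d) (cyc_diff q i)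
     then block_words x i (cyc_diff i d) (cyc_diff q i) else []) [0..<g])"

lemma match_msgs_row:
  "concat (map (match_msgs x d q) [0..<g]) = map (\<lambda>v. (int (d * g + q), [v])) (row_words x d q)"
  unfolding row_words_def map_concat map_map
  by (intro arg_cong[where f = concat] map_cong) (auto simp: match_msgs_def)

lemma length_block_words: "length (block_words x i j k) \<le> 3 * w"
  unfolding block_words_def
  using length_concat_filter_le[where P = "\<lambda>_. True" and c = 3 and xs = "[0..<w]" and
      f = "\<lambda>u. pick x 0 i u @ pick x 1 j u @ pick x 2 k u"]
  by (simp add: pick_def)

text \<open>At most 12 triples pass, and each contributes up to \<open>w\<close> sampled elements
  from each of three blocks.\<close>

lemma length_row_words:
  assumes "x < g" "d < g" "q < g"
  shows "length (row_words x d q) \<le> 36 * w"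
proof -
  let ?r = "\<lambda>i. relevant x i (cyc_diff i d) (cyc_diff q i)"
  have "length (row_words x d q) \<le> 3 * w * length (filter ?r [0..<g])"
    unfolding row_words_def by (intro length_concat_filter_le length_block_words)
  also have "length (filter ?r [0..<g]) = card {i. i < g \<and> ?r i}"
    by (subst distinct_card[symmetric]) (auto intro: arg_cong[where f = card])
  also have "3 * w * card {i. i < g \<and> ?r i} \<le> 3 * w * 12"
    using card_relevant[OF assms] by (intro mult_le_mono2)
  finally show ?thesis by simp
qed

text \<open>Even a spurious triple consists of input elements, so sending it cannot create a false
  solution.\<close>

lemma row_words_sound:
  assumes "v \<in> set (row_words x d q)"
  shows "\<exists>l<3. \<exists>i<n. v = 3 * F l i + int l"
proof -
  obtain l b u where "l < 3" "v \<in> set (pick x l b u)"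
  proof -
    obtain i where "v \<in> set (block_words x i (cyc_diff i d) (cyc_diff q i))"
      using assms unfolding row_words_def by (auto split: if_splits)
    then obtain u where "v \<in> set (pick x 0 i u) \<or> v \<in> set (pick x 1 (cyc_diff i d) u) \<or>
        v \<in> set (pick x 2 (cyc_diff q i) u)"
      unfolding block_words_def by auto
    then show thesis using that[of 0] that[of 1] that[of 2] by auto
  qed
  then show ?thesis unfolding pick_def by (auto split: if_splits)
qed

text \<open>Position \<open>a\<close> splits into block number, entry inside the block and
  residue.\<close>

lemma pick_block:
  assumes "a < n"
  shows "3 * F l a + int l \<in> set (pick (a mod g) l (a div (g * w)) (a div g mod w))"
proof -
  have "(a div (g * w) * w + a div g mod w) * g + a mod g = a"
    by (simp add: div_mult2_eq)
  then show ?thesis using assms unfolding pick_def by simp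
qed

lemma block_bounds:
  assumes "a < n" "x < g"
  defines "b \<equiv> a div (g * w)"
  shows "b * w * g \<le> a" "a < (b + 1) * w * g" "b < g"
proof -
  have P: "0 < g * w" using g_pos w_pos by simp
  have "b * (g * w) \<le> a" unfolding b_def by simp
  then show "b * w * g \<le> a" by (simp add: mult_ac)
  have "a < b * (g * w) + g * w"
    unfolding b_def using P by (metis add.commute dividend_less_div_times)
  then show "a < (b + 1) * w * g" by (simp add: algebra_simps)
  show "b < g" unfolding b_def
    using assms(1) size_less by (intro less_mult_imp_div_less) (simp add: mult_ac)
qed

text \<open>Each test would separate the sum of two bounds from the third bound, contradicting
  \<open>F 0 a + F 1 b = F 2 c\<close> by monotonicity. It matters that this holds for every
  \<open>x\<close>: the three elements usually lie in different samples, and each of these has to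
  pass the triple.\<close>

lemma solution_relevant:
  assumes a: "a < n" "b < n" "c < n" and sum: "F 0 a + F 1 b = F 2 c" and x: "x < g"
  shows "relevant x (a div (g * w)) (b div (g * w)) (c div (g * w))"
proof -
  let ?i = "a div (g * w)" and ?j = "b div (g * w)" and ?k = "c div (g * w)"
  note A = block_bounds[OF a(1) x] and B = block_bounds[OF a(2) x] and C = block_bounds[OF a(3) x]
  have before: "F l ((e * w - 1) * g + x) \<le> F l f" if lf: "l < 3" "0 < e" "e * w * g \<le> f" "f < n" for l e f
  proof -
    obtain c where "e * w = Suc c" using lf(2) w_pos by (metis Suc_pred nat_0_less_mult_iff)
    then have "(e * w - 1) * g + x \<le> f" using lf(3) x by simp
    then show ?thesis using F_mono lf by blast
  qed
  have after: "F l f \<le> F l ((e + 1) * w * g + x)" if "l < 3" "(e + 1) * w * g + x < n" "f < (e + 1) * w * g" for l e f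
    using that by (intro F_mono) auto
  show ?thesis
    unfolding relevant_def
  proof (intro conjI notI)
    assume *: "0 < ?i \<and> 0 < ?j \<and> (?k + 1) * w * g + x < n \<and>
        F 2 ((?k + 1) * w * g + x) < F 0 ((?i * w - 1) * g + x) + F 1 ((?j * w - 1) * g + x)"
    then show False
      using before[of 0 ?i a] before[of 1 ?j b] after[of 2 ?k c] A(1) B(1) C(2) a sum by simp
  next
    assume *: "0 < ?k \<and> (?i + 1) * w * g + x < n \<and> (?j + 1) * w * g + x < n \<and>
        F 0 ((?i + 1) * w * g + x) + F 1 ((?j + 1) * w * g + x) < F 2 ((?k * w - 1) * g + x)"
    then show False
      using after[of 0 ?i a] after[of 1 ?j b] before[of 2 ?k c] A(2) B(2) C(1) a sum by simp
  qed (use A(1) B(1) C(1) a in linarith)+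
qed

text \<open>The three residues may differ, but \<open>d\<close> and \<open>q\<close> depend on the
  block numbers only, so the three elements are sent to the same machine.\<close>

lemma row_words_complete:
  assumes a: "a < n" "b < n" "c < n" and sum: "F 0 a + F 1 b = F 2 c"
  shows "\<exists>d<g. \<exists>q<g. 3 * F 0 a \<in> set (row_words (a mod g) d q) \<and>
    3 * F 1 b + 1 \<in> set (row_words (b mod g) d q) \<and> 3 * F 2 c + 2 \<in> set (row_words (c mod g) d q)"
proof -
  let ?i = "a div (g * w)" and ?j = "b div (g * w)" and ?k = "c div (g * w)"
  define d where "d = cyc_diff ?i ?j"
  define q where "q = (?i + ?k) mod g"
  have ijk: "?i < g" "?j < g" "?k < g" using block_bounds(3)[of _ 0] a g_pos by blast+
  have dq: "d < g" "q < g" unfolding d_def q_def using cyc_diff_less g_pos by auto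
  \<comment> \<open>Block numbers are below \<open>g\<close>, so \<open>d\<close>, \<open>q\<close>
    and \<open>i\<close> give back \<open>j\<close> and \<open>k\<close> exactly and not just modulo
    \<open>g\<close>.\<close>
  have j: "cyc_diff ?i d = ?j"
    using ijk dq unfolding d_def by (simp add: cyc_diff_eq split: if_splits)
  have k: "cyc_diff q ?i = ?k"
    using ijk dq(2) by (auto simp: cyc_diff_eq q_def mod_if)
  have in_row: "v \<in> set (row_words x d q)"
    if "x < g" "u < w" "v \<in> set (pick x 0 ?i u @ pick x 1 ?j u @ pick x 2 ?k u)" for v x u
  proof -
    have "v \<in> set (block_words x ?i ?j ?k)"
      using that(2,3) unfolding block_words_def by auto
    moreover have "relevant x ?i ?j ?k" using solution_relevant[OF a sum that(1)] .
    ultimately have "v \<in> set (if relevant x ?i (cyc_diff ?i d) (cyc_diff q ?i)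
        then block_words x ?i (cyc_diff ?i d) (cyc_diff q ?i) else [])"
      unfolding j k by simp
    then show ?thesis unfolding row_words_def using ijk(1) by (simp only: set_concat set_map) auto
  qed
  have "3 * F 0 a \<in> set (row_words (a mod g) d q)"
    using in_row[of "a mod g" "a div g mod w"] pick_block[OF a(1), of 0] g_pos w_pos by simp
  moreover have "3 * F 1 b + 1 \<in> set (row_words (b mod g) d q)"
    using in_row[of "b mod g" "b div g mod w"] pick_block[OF a(2), of 1] g_pos w_pos by simp
  moreover have "3 * F 2 c + 2 \<in> set (row_words (c mod g) d q)"
    using in_row[of "c mod g" "c div g mod w"] pick_block[OF a(3), of 2] g_pos w_pos by simp
  ultimately show ?thesis using dq by blast
qed

end

section \<open>Message traffic\<close>

definition inputs_at :: "nat \<Rightarrow> (nat \<Rightarrow> nat \<Rightarrow> nat) \<Rightarrow> nat \<Rightarrow> (nat \<times> nat) list" where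
  "inputs_at n p k = filter (\<lambda>(l, i). p l i = k) (List.product [0..<3] [0..<n])"

lemma concat_if_singleton: "concat (map (\<lambda>x. if P x then [f x] else []) xs) = map f (filter P xs)"
  by (induction xs) auto

lemma initial_inbox_eq:
  "initial_inbox n A B C p m =
     concat (map (\<lambda>(l, i). [int l, int i, ([A, B, C] ! l) ! i]) (inputs_at n p m))"
proof -
  have "filter (\<lambda>(l, i). p l i = m) (List.product xs ys) =
      concat (map (\<lambda>l. map (Pair l) (filter (\<lambda>i. p l i = m) ys)) xs)" for xs ys :: "nat list"
    by (induction xs) (auto simp: filter_map comp_def)
  then show ?thesis
    unfolding initial_inbox_def inputs_at_def
    by (simp only: concat_if_singleton map_concat map_map comp_def prod.case)
qed

lemma set_inputs_at: "set (inputs_at n p k) = {(l, i). l < 3 \<and> i < n \<and> p l i = k}"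
  unfolding inputs_at_def by auto

lemma distinct_inputs_at: "distinct (inputs_at n p k)"
  unfolding inputs_at_def by (intro distinct_filter distinct_product) auto

lemma concat_if_unique:
  assumes "distinct xs"
  shows "concat (map (\<lambda>x. if x = a then f x else []) xs) = (if a \<in> set xs then f a else [])"
  using assms by (induction xs) auto

lemma wp_local_phase:
  assumes "\<And>m. m < M \<Longrightarrow> length (inbox m) \<le> S"
    and "\<And>m. m < M \<Longrightarrow> wp W S c (start n M S m (inbox m)) (Q m)"
  obtains t \<tau> where "local_phase W n M S c inbox t \<tau>" "\<And>m. m < M \<Longrightarrow> Q m (t m) (\<tau> m)"
proof -
  have "\<forall>m. \<exists>r. m < M \<longrightarrow> exec W S c (start n M S m (inbox m)) (fst r) (snd r) \<and> Q m (fst r) (snd r)"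
    using assms(2) unfolding wp_def by (metis fst_conv snd_conv)
  then obtain r where "\<And>m. m < M \<Longrightarrow> exec W S c (start n M S m (inbox m)) (fst (r m)) (snd (r m)) \<and>
      Q m (fst (r m)) (snd (r m))" by metis
  then show thesis
    using assms(1) that[of "\<lambda>m. fst (r m)" "\<lambda>m. snd (r m)"] unfolding local_phase_def by blast
qed

lemma div_mod_eq_iff: "b < g \<Longrightarrow> a * g + b = m \<longleftrightarrow> a = m div g \<and> b = m mod g" for a b g m :: nat
  by auto

context grid
begin

section \<open>The exchange after the first round\<close>

lemma scatter_msgs_to:
  assumes "m < g * g"
  shows "concat (map snd (filter (\<lambda>(d, ws). d = int m) (scatter_msgs (l, i)))) =
    (if i mod g = m div g then [int (key_address (l, i)), F l i] else [])"
proof -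
  let ?v = "[int (key_address (l, i)), F l i]"
  have "concat (map snd (filter (\<lambda>(d, ws). d = int m) (map (\<lambda>d. (int (h d), ?v)) xs))) =
      concat (map (\<lambda>d. if h d = m then ?v else []) xs)" for h :: "nat \<Rightarrow> nat" and xs
    by (induction xs) auto
  then have "concat (map snd (filter (\<lambda>(d, ws). d = int m) (scatter_msgs (l, i)))) =
      concat (map (\<lambda>d. if i mod g * g + d = m then ?v else []) [0..<g])"
    unfolding scatter_msgs_def prod.case .
  also have "\<dots> = concat (map (\<lambda>d. if d = m mod g then (if i mod g = m div g then ?v else []) else []) [0..<g])"
    by (intro arg_cong[where f = concat] map_cong) (auto simp: div_mod_eq_iff)
  finally show ?thesis using g_pos by (simp add: concat_if_unique)
qed

lemma scatter_outbox_to: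
  assumes "m < g * g"
  shows "concat (map snd (filter (\<lambda>(d, ws). d = int m) (concat (map scatter_msgs recs)))) =
    concat (map (\<lambda>(l, i). [int (key_address (l, i)), F l i]) (filter (\<lambda>(l, i). i mod g = m div g) recs))"
  by (induction recs) (simp_all add: scatter_msgs_to[OF assms] split_paired_all)

text \<open>The keys in the order of delivery. This order depends on the placement \<open>p\<close>,
  the set of keys does not.\<close>

definition sample_keys :: "(nat \<Rightarrow> nat \<Rightarrow> nat) \<Rightarrow> nat \<Rightarrow> (nat \<times> nat) list" where
  "sample_keys p m =
     concat (map (\<lambda>k. filter (\<lambda>(l, i). i mod g = m div g) (inputs_at n p k)) [0..<g * g])"

lemma deliver_scatter:
  assumes "m < g * g" "\<And>k. k < g * g \<Longrightarrow> outbox k = concat (map scatter_msgs (inputs_at n p k))"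
  shows "deliver (g * g) outbox m =
    concat (map (\<lambda>(l, i). [int (key_address (l, i)), F l i]) (sample_keys p m))"
proof -
  have "deliver (g * g) outbox m = concat (map (\<lambda>k. concat (map (\<lambda>(l, i). [int (key_address (l, i)), F l i])
      (filter (\<lambda>(l, i). i mod g = m div g) (inputs_at n p k)))) [0..<g * g])"
    unfolding deliver_def
    by (rule arg_cong[where f = concat], rule map_cong) (simp_all add: assms(2) scatter_outbox_to[OF assms(1)])
  also have "\<dots> = concat (map (\<lambda>(l, i). [int (key_address (l, i)), F l i]) (sample_keys p m))"
  proof -
    have "concat (map (\<lambda>k. concat (map h (f k))) ks) = concat (map h (concat (map f ks)))"
      for h :: "nat \<times> nat \<Rightarrow> int list" and f and ks :: "nat list"
      by (induction ks) auto
    then show ?thesis unfolding sample_keys_def .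
  qed
  finally show ?thesis .
qed

lemma set_sample_keys:
  assumes "\<And>l i. l < 3 \<Longrightarrow> i < n \<Longrightarrow> p l i < g * g"
  shows "set (sample_keys p m) = {(l, i). l < 3 \<and> i < n \<and> i mod g = m div g}"
  unfolding sample_keys_def using assms by (auto simp: set_inputs_at)

text \<open>Every key is placed on exactly one machine, so the counts over the senders add up to the
  number of keys with the given residue; for these \<open>i div g\<close> determines
  \<open>i\<close>.\<close>

lemma length_sample_keys:
  assumes p: "\<And>l i. l < 3 \<Longrightarrow> i < n \<Longrightarrow> p l i < g * g"
  shows "length (sample_keys p m) \<le> 3 * (g * w)"
proof -
  let ?X = "{(l::nat, i). l < 3 \<and> i < n \<and> i mod g = m div g}"
  have fin: "finite ?X" by (rule finite_subset[of _ "{..<3::nat} \<times> {..<n}"]) auto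
  have "length (filter (\<lambda>(l, i). i mod g = m div g) (inputs_at n p k)) = card {z \<in> ?X. case_prod p z = k}" for k
    by (subst distinct_card[symmetric])
      (auto simp: distinct_inputs_at set_inputs_at intro!: arg_cong[where f = card])
  then have "length (sample_keys p m) = (\<Sum>k<g * g. card {z \<in> ?X. case_prod p z = k})"
    unfolding sample_keys_def length_concat map_map comp_def
    by (simp add: interv_sum_list_conv_sum_set_nat atLeast0LessThan)
  also have "\<dots> = (\<Sum>k<g * g. \<Sum>z\<in>{z \<in> ?X. case_prod p z = k}. 1)" by simp
  also have "\<dots> = (\<Sum>z\<in>?X. 1)" using fin p by (intro sum.group) auto
  also have "\<dots> = card ?X" by simp
  also have "\<dots> \<le> card ({..<3::nat} \<times> {..<g * w})"
  proof (rule card_inj_on_le)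
    show "inj_on (\<lambda>(l, i). (l, i div g)) ?X"
      by (rule inj_onI) (auto, metis div_mult_mod_eq)
    show "(\<lambda>(l, i). (l, i div g)) ` ?X \<subseteq> {..<3} \<times> {..<g * w}" using div_less by auto
  qed simp
  finally show ?thesis by simp
qed

text \<open>Up to \<open>3 * w\<close> records, \<open>g\<close> messages for each, and 3 words per
  message: address, key and value.\<close>

lemma legal_scatter:
  assumes "length recs \<le> 3 * w"
  shows "legal_outbox (g * g) S (concat (map scatter_msgs recs))"
proof -
  have "(\<Sum>(d, ws)\<leftarrow>concat (map scatter_msgs recs). 1 + length ws) = 3 * g * length recs"
    unfolding scatter_msgs_def by (induction recs) (auto simp: comp_def sum_list_triv)
  also have "\<dots> \<le> 3 * g * (3 * w)" using assms by (rule mult_le_mono2)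
  also have "\<dots> \<le> S" by simp
  finally have "(\<Sum>(d, ws)\<leftarrow>concat (map scatter_msgs recs). 1 + length ws) \<le> S" .
  moreover have "0 \<le> d \<and> d < int (g * g)" if "(d, ws) \<in> set (scatter_msgs z)" for d ws z
  proof -
    obtain i e where "d = int (i mod g * g + e)" "e < g"
      using \<open>(d, ws) \<in> set (scatter_msgs z)\<close> unfolding scatter_msgs_def by (auto split: prod.splits)
    moreover have "i mod g * g + e < g * g" if "e < g" for i e
    proof -
      have "i mod g * g + e < (i mod g + 1) * g" using that by simp
      also have "\<dots> \<le> g * g" using g_pos by (intro mult_le_mono1) (simp add: Suc_le_eq)
      finally show ?thesis .
    qed
    ultimately show ?thesis by (simp del: of_nat_mult of_nat_add)
  qed
  ultimately show ?thesis unfolding legal_outbox_def by auto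
qed

section \<open>The exchange after the second round\<close>

definition row_msgs :: "nat \<Rightarrow> (int \<times> int list) list" where
  "row_msgs k = concat (map (\<lambda>q. concat (map (match_msgs (k div g) (k mod g) q) [0..<g])) [0..<g])"

lemma row_msgs_eq:
  "row_msgs k = concat (map (\<lambda>q. map (\<lambda>v. (int (k mod g * g + q), [v])) (row_words (k div g) (k mod g) q)) [0..<g])"
  unfolding row_msgs_def match_msgs_row ..

lemma legal_row_msgs:
  assumes "k < g * g"
  shows "legal_outbox (g * g) S (row_msgs k)"
proof -
  let ?x = "k div g" and ?d = "k mod g"
  have xd: "?x < g" "?d < g" using assms g_pos by (simp_all add: less_mult_imp_div_less)
  have "(\<Sum>(d, ws)\<leftarrow>row_msgs k. 1 + length ws) = (\<Sum>q\<leftarrow>[0..<g]. 2 * length (row_words ?x ?d q))"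
  proof -
    have "(\<Sum>(d, ws)\<leftarrow>concat (map (\<lambda>q. map (\<lambda>v. (h q, [v])) (f q)) qs). 1 + length ws) =
        (\<Sum>q\<leftarrow>qs. 2 * length (f q))" for h :: "nat \<Rightarrow> int" and f :: "nat \<Rightarrow> int list" and qs
      by (induction qs) (auto simp: comp_def sum_list_triv)
    then show ?thesis unfolding row_msgs_eq .
  qed
  also have "\<dots> \<le> (\<Sum>q\<leftarrow>[0..<g]. 2 * (36 * w))"
    using length_row_words[OF xd] by (intro sum_list_mono mult_le_mono2) simp
  \<comment> \<open>Origin of the constant 72: \<open>g\<close> recipients, \<open>36 * w\<close>
    elements for each, and an address word for every element.\<close>
  also have "\<dots> = S" by (simp add: sum_list_triv)
  finally have "(\<Sum>(d, ws)\<leftarrow>row_msgs k. 1 + length ws) \<le> S" .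
  moreover have "0 \<le> d \<and> d < int (g * g)" if dws: "(d, ws) \<in> set (row_msgs k)" for d ws
  proof -
    obtain q where q: "d = int (?d * g + q)" "q < g"
      using dws unfolding row_msgs_eq by (auto simp del: of_nat_add of_nat_mult)
    have "?d * g + q < (?d + 1) * g" using q(2) by simp
    also have "\<dots> \<le> g * g" using xd(2) by (intro mult_le_mono1) linarith
    finally show ?thesis unfolding q(1) by (simp del: of_nat_mult of_nat_add)
  qed
  ultimately show ?thesis unfolding legal_outbox_def by auto
qed

text \<open>Machine numbers now change their meaning: the recipient \<open>m\<close> is read as
  \<open>(d, q)\<close>, whereas the senders \<open>k\<close> are the machines \<open>(x, d)\<close>
  of the same diagonal.\<close>

definition final_inbox :: "nat \<Rightarrow> int list" where
  "final_inbox m = concat (map (\<lambda>k. if k mod g = m div g then row_words (k div g) (m div g) (m mod g) else []) [0..<g * g])"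

lemma deliver_row_msgs:
  assumes "m < g * g" "\<And>k. k < g * g \<Longrightarrow> outbox k = row_msgs k"
  shows "deliver (g * g) outbox m = final_inbox m"
proof -
  have "concat (map snd (filter (\<lambda>(d, ws). d = int m) (row_msgs k))) =
      (if k mod g = m div g then row_words (k div g) (m div g) (m mod g) else [])" for k
  proof -
    let ?r = "row_words (k div g) (k mod g)"
    have one: "concat (map snd (filter (\<lambda>(d, ws). d = int m) (map (\<lambda>v. (int a, [v])) xs))) =
        (if a = m then xs else [])" for a and xs :: "int list"
      by (induction xs) auto
    have "concat (map snd (filter (\<lambda>(d, ws). d = int m)
          (concat (map (\<lambda>q. map (\<lambda>v. (int (k mod g * g + q), [v])) (?r q)) qs)))) =
        concat (map (\<lambda>q. if k mod g * g + q = m then ?r q else []) qs)" for qs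
      by (induction qs) (simp_all add: one del: of_nat_add of_nat_mult)
    then have "concat (map snd (filter (\<lambda>(d, ws). d = int m) (row_msgs k))) =
        concat (map (\<lambda>q. if k mod g * g + q = m then ?r q else []) [0..<g])"
      unfolding row_msgs_eq .
    also have "\<dots> = concat (map (\<lambda>q. if q = m mod g then (if k mod g = m div g then ?r q else []) else []) [0..<g])"
      by (intro arg_cong[where f = concat] map_cong) (auto simp: div_mod_eq_iff)
    finally show ?thesis using g_pos by (simp add: concat_if_unique)
  qed
  then show ?thesis
    unfolding deliver_def final_inbox_def
    by (intro arg_cong[where f = concat] map_cong) (simp_all add: assms(2))
qed

text \<open>One sender for each of the \<open>g\<close> residues, so different samples may even pass
  different triples without exceeding the memory.\<close>

lemma length_final_inbox:
  assumes "m < g * g"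
  shows "length (final_inbox m) \<le> 36 * (g * w)"
proof -
  let ?d = "m div g" and ?q = "m mod g"
  have dq: "?d < g" "?q < g" using assms g_pos by (simp_all add: less_mult_imp_div_less)
  have "length (final_inbox m) = (\<Sum>k<g * g. length (if k mod g = ?d then row_words (k div g) ?d ?q else []))"
    unfolding final_inbox_def length_concat map_map comp_def
    by (simp add: interv_sum_list_conv_sum_set_nat atLeast0LessThan)
  also have "\<dots> \<le> (\<Sum>k<g * g. if k mod g = ?d then 36 * w else 0)"
    using length_row_words[OF _ dq] by (intro sum_mono) (auto simp: less_mult_imp_div_less)
  also have "\<dots> = card {k \<in> {..<g * g}. k mod g = ?d} * (36 * w)"
    by (simp flip: sum.inter_filter)
  also have "card {k \<in> {..<g * g}. k mod g = ?d} \<le> card {..<g}"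
  proof (rule card_inj_on_le)
    show "inj_on (\<lambda>k. k div g) {k \<in> {..<g * g}. k mod g = ?d}"
      by (rule inj_onI) (auto, metis div_mult_mod_eq)
    show "(\<lambda>k. k div g) ` {k \<in> {..<g * g}. k mod g = ?d} \<subseteq> {..<g}"
      by (auto simp: less_mult_imp_div_less)
  qed simp
  finally show ?thesis by (simp add: mult_ac)
qed

section \<open>Correctness of the answer and composition of the phases\<close>

lemma final_inbox_sound:
  assumes "v \<in> set (final_inbox m)"
  shows "\<exists>l<3. \<exists>i<n. v = 3 * F l i + int l"
proof -
  obtain x d q where "v \<in> set (row_words x d q)"
    using assms unfolding final_inbox_def by (auto split: if_splits)
  then show ?thesis by (rule row_words_sound)
qed

lemma row_words_final_inbox:
  assumes "x < g" "d < g" "q < g"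
  shows "set (row_words x d q) \<subseteq> set (final_inbox (d * g + q))"
proof -
  have "x * g + d < (x + 1) * g" using assms(2) by simp
  also have "\<dots> \<le> g * g" using assms(1) by (intro mult_le_mono1) simp
  finally have k: "x * g + d < g * g" .
  have "(d * g + q) div g = d" "(d * g + q) mod g = q" "(x * g + d) div g = x" "(x * g + d) mod g = d"
    using assms by simp_all
  then have "set (row_words x d q) = set (if (x * g + d) mod g = (d * g + q) div g
      then row_words ((x * g + d) div g) ((d * g + q) div g) ((d * g + q) mod g) else [])" by simp
  also have "\<dots> \<subseteq> set (final_inbox (d * g + q))"
    unfolding final_inbox_def set_concat set_map using k by (intro Union_upper imageI) auto
  finally show ?thesis .
qed

lemma final_answer:
  "(\<exists>m<g * g. \<exists>a b. 3 * a \<in> set (final_inbox m) \<and> 3 * b + 1 \<in> set (final_inbox m) \<and>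
      3 * (a + b) + 2 \<in> set (final_inbox m)) \<longleftrightarrow>
    (\<exists>a<n. \<exists>b<n. \<exists>c<n. F 0 a + F 1 b = F 2 c)" (is "?l \<longleftrightarrow> ?r")
proof
  assume ?l
  then obtain m a b where *: "3 * a \<in> set (final_inbox m)" "3 * b + 1 \<in> set (final_inbox m)"
      "3 * (a + b) + 2 \<in> set (final_inbox m)" by blast
  have "\<exists>i<n. v = F l i" if v: "3 * v + int l \<in> set (final_inbox m)" and l: "l < 3" for v l
  proof -
    obtain l' i where li: "l' < 3" "i < n" "3 * v + int l = 3 * F l' i + int l'"
      using final_inbox_sound[OF v] by blast
    \<comment> \<open>Both tags are below 3, so the remainder modulo 3 identifies the list.\<close>
    then have "l' = l" using l by presburger
    with li show ?thesis by auto
  qed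
  from this[of a 0] this[of b 1] this[of "a + b" 2] * show ?r by auto
next
  assume ?r
  then obtain a b c where *: "a < n" "b < n" "c < n" "F 0 a + F 1 b = F 2 c" by blast
  obtain d q where dq: "d < g" "q < g" "3 * F 0 a \<in> set (row_words (a mod g) d q)"
    "3 * F 1 b + 1 \<in> set (row_words (b mod g) d q)" "3 * F 2 c + 2 \<in> set (row_words (c mod g) d q)"
    using row_words_complete[OF *] by blast
  have "d * g + q < (d + 1) * g" using dq(2) by simp
  also have "\<dots> \<le> g * g" using dq(1) by (intro mult_le_mono1) simp
  finally have "d * g + q < g * g" .
  moreover have "3 * F 0 a \<in> set (final_inbox (d * g + q))" "3 * F 1 b + 1 \<in> set (final_inbox (d * g + q))"
    "3 * (F 0 a + F 1 b) + 2 \<in> set (final_inbox (d * g + q))"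
    using row_words_final_inbox[of "a mod g" d q] row_words_final_inbox[of "b mod g" d q]
      row_words_final_inbox[of "c mod g" d q] dq g_pos unfolding *(4) by auto
  ultimately show ?l by blast
qed

lemma run_exists:
  assumes p: "\<And>l i. l < 3 \<Longrightarrow> i < n \<Longrightarrow> p l i < g * g"
    and share: "\<And>k. k < g * g \<Longrightarrow> card {(l, i). l < 3 \<and> i < n \<and> p l i = k} \<le> 3 * w"
    and inbox: "\<And>k. inbox k = concat (map (\<lambda>(l, i). [int l, int i, F l i]) (inputs_at n p k))"
  shows "\<exists>t \<le> 275000 * (g * (g * w))\<^sup>2.
    mr_run W n (g * g) S [scatter, match_blocks] search inbox t
      (\<exists>a<n. \<exists>b<n. \<exists>c<n. F 0 a + F 1 b = F 2 c)"
proof -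
  let ?M = "g * g"
  have len1: "length (inputs_at n p k) \<le> 3 * w" if "k < ?M" for k
    using share[OF that] distinct_card[OF distinct_inputs_at, of n p k] unfolding set_inputs_at by simp
  have P: "1 \<le> g * w" using g_pos w_pos by simp
  obtain t1 \<tau>1 where 1: "local_phase W n ?M S scatter inbox t1 \<tau>1"
    "\<And>m. m < ?M \<Longrightarrow> t1 m \<le> 300 * (g * w) \<and> sent (\<tau>1 m) = concat (map scatter_msgs (inputs_at n p m))"
  proof (rule wp_local_phase[where c = scatter and W = W and n = n and S = S and M = ?M and inbox = inbox and
        Q = "\<lambda>m t \<tau>. t \<le> 300 * (g * w) \<and> sent \<tau> = concat (map scatter_msgs (inputs_at n p m))"])
    fix m
    assume m: "m < ?M"
    have "length (inbox m) = 3 * length (inputs_at n p m)"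
      unfolding inbox by (intro length_concat_uniform) (simp split: prod.split)
    then show "length (inbox m) \<le> S" using len1[OF m] w_le by linarith
    show "wp W S scatter (start n ?M S m (inbox m)) (\<lambda>t \<tau>. t \<le> 300 * (g * w) \<and>
        sent \<tau> = concat (map scatter_msgs (inputs_at n p m)))"
      unfolding inbox using len1[OF m] by (intro wp_scatter) (auto simp: set_inputs_at)
  qed blast
  let ?in2 = "deliver ?M (\<lambda>m. sent (\<tau>1 m))"
  have in2: "?in2 m = concat (map (\<lambda>(l, i). [int (key_address (l, i)), F l i]) (sample_keys p m))"
    if "m < ?M" for m
    using 1(2) by (intro deliver_scatter[OF that]) blast
  obtain t2 \<tau>2 where 2: "local_phase W n ?M S match_blocks ?in2 t2 \<tau>2"
    "\<And>m. m < ?M \<Longrightarrow> t2 m \<le> 600 * (g * w)\<^sup>2 \<and> sent (\<tau>2 m) = row_msgs m"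
  proof (rule wp_local_phase[where c = match_blocks and W = W and n = n and S = S and M = ?M and inbox = ?in2 and
        Q = "\<lambda>m t \<tau>. t \<le> 600 * (g * w)\<^sup>2 \<and> sent \<tau> = row_msgs m"])
    fix m
    assume m: "m < ?M"
    have "length (?in2 m) = 2 * length (sample_keys p m)"
      unfolding in2[OF m] by (intro length_concat_uniform) (simp split: prod.split)
    then show "length (?in2 m) \<le> S" using length_sample_keys[where p = p and m = m, OF p] by linarith
    show "wp W S match_blocks (start n ?M S m (?in2 m)) (\<lambda>t \<tau>. t \<le> 600 * (g * w)\<^sup>2 \<and> sent \<tau> = row_msgs m)"
      unfolding row_msgs_def
      by (rule wp_match_blocks[OF set_sample_keys[where p = p, OF p] length_sample_keys[where p = p, OF p] m in2[OF m]])
  qed blast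
  let ?in3 = "deliver ?M (\<lambda>m. sent (\<tau>2 m))"
  have in3: "?in3 m = final_inbox m" if "m < ?M" for m
    using 2(2) by (intro deliver_row_msgs[OF that]) blast
  let ?ans = "\<lambda>m. \<exists>a b. 3 * a \<in> set (final_inbox m) \<and> 3 * b + 1 \<in> set (final_inbox m) \<and>
        3 * (a + b) + 2 \<in> set (final_inbox m)"
  obtain t3 \<tau>3 where 3: "local_phase W n ?M S search ?in3 t3 \<tau>3"
    "\<And>m. m < ?M \<Longrightarrow> t3 m \<le> 200 * (length (final_inbox m) + 1)\<^sup>2 \<and> (regs (\<tau>3 m) 5 \<noteq> 0 \<longleftrightarrow> ?ans m)"
  proof (rule wp_local_phase[where c = search and W = W and n = n and S = S and M = ?M and inbox = ?in3 and
        Q = "\<lambda>m t \<tau>. t \<le> 200 * (length (final_inbox m) + 1)\<^sup>2 \<and> (regs \<tau> 5 \<noteq> 0 \<longleftrightarrow> ?ans m)"])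
    fix m
    assume m: "m < ?M"
    have l: "length (final_inbox m) \<le> S" using length_final_inbox[OF m] by linarith
    then show "length (?in3 m) \<le> S" unfolding in3[OF m] .
    have "\<forall>v\<in>set (final_inbox m). \<bar>v\<bar> \<le> W"
      using final_inbox_sound value_fits_word(2) by blast
    then show "wp W S search (start n ?M S m (?in3 m)) (\<lambda>t \<tau>. t \<le> 200 * (length (final_inbox m) + 1)\<^sup>2 \<and>
        (regs \<tau> 5 \<noteq> 0 \<longleftrightarrow> ?ans m))"
      unfolding in3[OF m] using l word_small[OF l] W_pos by (intro wp_search) linarith+
  qed blast
  have "mr_run W n ?M S [] search ?in3 (\<Sum>m<?M. t3 m) (\<exists>m<?M. regs (\<tau>3 m) 5 \<noteq> 0)"
    by (rule mr_run.finish[OF 3(1)])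
  moreover have "(\<exists>m<?M. regs (\<tau>3 m) 5 \<noteq> 0) \<longleftrightarrow> (\<exists>a<n. \<exists>b<n. \<exists>c<n. F 0 a + F 1 b = F 2 c)"
    using 3(2) final_answer by metis
  ultimately have "mr_run W n ?M S [] search ?in3 (\<Sum>m<?M. t3 m)
      (\<exists>a<n. \<exists>b<n. \<exists>c<n. F 0 a + F 1 b = F 2 c)" by simp
  then have "mr_run W n ?M S [match_blocks] search ?in2 ((\<Sum>m<?M. t2 m) + (\<Sum>m<?M. t3 m))
      (\<exists>a<n. \<exists>b<n. \<exists>c<n. F 0 a + F 1 b = F 2 c)"
    by (rule mr_run.round[OF 2(1), rotated]) (simp add: 2(2) legal_row_msgs)
  then have "mr_run W n ?M S [scatter, match_blocks] search inbox
      ((\<Sum>m<?M. t1 m) + ((\<Sum>m<?M. t2 m) + (\<Sum>m<?M. t3 m)))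
      (\<exists>a<n. \<exists>b<n. \<exists>c<n. F 0 a + F 1 b = F 2 c)"
    by (rule mr_run.round[OF 1(1), rotated]) (simp add: 1(2) legal_scatter len1)
  moreover have "(\<Sum>m<?M. t1 m) + ((\<Sum>m<?M. t2 m) + (\<Sum>m<?M. t3 m)) \<le> 275000 * (g * (g * w))\<^sup>2"
  proof -
    \<comment> \<open>In units of the square of \<open>g * w\<close> the phases cost at most 300,
      600 and \<open>200 * 37 * 37\<close>, which is 274700 in total; 37 covers the
      \<open>36 * (g * w)\<close> inbox words plus one.\<close>
    have "t1 m + (t2 m + t3 m) \<le> 275000 * (g * w)\<^sup>2" if m: "m < ?M" for m
    proof -
      have "(length (final_inbox m) + 1)\<^sup>2 \<le> (37 * (g * w))\<^sup>2"
        using length_final_inbox[OF m] P by (intro power_mono) linarith+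
      moreover have "g * w \<le> (g * w)\<^sup>2" using P by (simp add: power2_eq_square)
      moreover have "(37 * (g * w))\<^sup>2 = 1369 * (g * w)\<^sup>2" by (simp add: power_mult_distrib)
      ultimately show ?thesis using 1(2)[OF m] 2(2)[OF m] 3(2)[OF m] by linarith
    qed
    then have "(\<Sum>m<?M. t1 m + (t2 m + t3 m)) \<le> (\<Sum>m<?M. 275000 * (g * w)\<^sup>2)"
      by (intro sum_mono) simp
    then show ?thesis by (simp add: sum.distrib power2_eq_square mult_ac)
  qed
  ultimately show ?thesis by blast
qed

end

section \<open>The asymptotic bounds\<close>

text \<open>The \<open>+ 1\<close> keeps the number of blocks positive at \<open>n = 0\<close>,
  where \<open>powr\<close> yields 0.\<close>

definition num_blocks :: "real \<Rightarrow> nat \<Rightarrow> nat" where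
  "num_blocks \<epsilon> n = nat \<lceil>real n powr (1 - \<epsilon>)\<rceil> + 1"

definition stride_blocks :: "real \<Rightarrow> nat \<Rightarrow> nat" where
  "stride_blocks \<epsilon> n = n div (num_blocks \<epsilon> n * num_blocks \<epsilon> n) + 1"

lemma num_blocks_pos: "0 < num_blocks \<epsilon> n"
  by (simp add: num_blocks_def)

lemma powr_le_self: "0 < n \<Longrightarrow> e \<le> 1 \<Longrightarrow> real n powr e \<le> real n"
  using powr_mono[of e 1 "real n"] by simp

lemma num_blocks_le:
  assumes "0 \<le> \<epsilon>"
  shows "num_blocks \<epsilon> n \<le> n + 1"
proof (cases "n = 0")
  case False
  then have "real n powr (1 - \<epsilon>) \<le> real n" using assms by (intro powr_le_self) auto
  then have "\<lceil>real n powr (1 - \<epsilon>)\<rceil> \<le> int n" by (simp add: ceiling_le_iff)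
  then show ?thesis unfolding num_blocks_def by linarith
qed (simp add: num_blocks_def)

text \<open>For positive \<open>n\<close> the power is at least 1, so it absorbs the ceiling and the
  \<open>+ 1\<close>, each costing at most 1.\<close>

lemma num_blocks_bounds:
  assumes "0 < n" "\<epsilon> \<le> 1"
  shows "real n powr (1 - \<epsilon>) \<le> real (num_blocks \<epsilon> n)"
    "real (num_blocks \<epsilon> n) \<le> 3 * real n powr (1 - \<epsilon>)"
proof -
  have "1 \<le> real n powr (1 - \<epsilon>)" using assms by (intro ge_one_powr_ge_zero) auto
  then show "real n powr (1 - \<epsilon>) \<le> real (num_blocks \<epsilon> n)"
    "real (num_blocks \<epsilon> n) \<le> 3 * real n powr (1 - \<epsilon>)"
    unfolding num_blocks_def by linarith+
qed

lemma num_machines_le: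
  assumes "0 < n" "\<epsilon> \<le> 1"
  shows "real (num_blocks \<epsilon> n * num_blocks \<epsilon> n) \<le> 9 * real n powr (2 * (1 - \<epsilon>))"
proof -
  have "real n powr (2 * (1 - \<epsilon>)) = real n powr (1 - \<epsilon>) * real n powr (1 - \<epsilon>)"
    by (simp flip: powr_add)
  moreover have "real (num_blocks \<epsilon> n) * real (num_blocks \<epsilon> n) \<le>
      (3 * real n powr (1 - \<epsilon>)) * (3 * real n powr (1 - \<epsilon>))"
    using num_blocks_bounds[OF assms] by (intro mult_mono) auto
  ultimately show ?thesis by simp
qed

lemma stride_blocks_le:
  "real (stride_blocks \<epsilon> n) \<le> real n / (real (num_blocks \<epsilon> n) * real (num_blocks \<epsilon> n)) + 1"
proof -
  have "real (n div m) \<le> real n / real m" for m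
    by (metis floor_divide_of_nat_eq of_int_floor_le of_int_of_nat_eq)
  then show ?thesis unfolding stride_blocks_def by (metis add_right_mono of_nat_1 of_nat_add of_nat_mult)
qed

text \<open>With \<open>g\<close> blocks, \<open>g * w\<close> is at most \<open>n / g + g\<close>.
  The first summand is at most \<open>n powr \<epsilon>\<close>; the second is of order
  \<open>n powr (1 - \<epsilon>)\<close>, and \<open>1 / 2 \<le> \<epsilon>\<close> makes this no
  larger.\<close>

lemma block_size_le:
  assumes "0 < n" "1 / 2 \<le> \<epsilon>" "\<epsilon> \<le> 1"
  shows "real (num_blocks \<epsilon> n * stride_blocks \<epsilon> n) \<le> 4 * real n powr \<epsilon>"
proof -
  let ?g = "real (num_blocks \<epsilon> n)" and ?y = "real n powr (1 - \<epsilon>)"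
  have g: "0 < ?g" using num_blocks_pos by simp
  have y: "0 < ?y" using assms by simp
  have "?g * real (stride_blocks \<epsilon> n) \<le> ?g * (real n / (?g * ?g) + 1)"
    using stride_blocks_le g by (intro mult_left_mono) auto
  also have "\<dots> = real n / ?g + ?g" using g by (simp add: field_simps)
  also have "real n / ?g \<le> real n / ?y"
    using num_blocks_bounds(1)[OF assms(1,3)] y g by (intro divide_left_mono mult_pos_pos) auto
  also have "real n / ?y = real n powr \<epsilon>"
    using assms(1) powr_diff[of "real n" 1 "1 - \<epsilon>"] by simp
  also have "?g \<le> 3 * real n powr \<epsilon>"
    using num_blocks_bounds(2)[OF assms(1,3)] powr_mono[of "1 - \<epsilon>" \<epsilon> "real n"] assms by simp
  finally show ?thesis by simp
qed

text \<open>Here \<open>g * g * w \<le> n + g * g\<close>, and the number \<open>g * g\<close> of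
  machines is linear in \<open>n\<close> because
  \<open>2 * (1 - \<epsilon>) \<le> 1\<close>.\<close>

lemma total_work_le:
  assumes "0 < n" "1 / 2 \<le> \<epsilon>" "\<epsilon> \<le> 1"
  shows "real (num_blocks \<epsilon> n * (num_blocks \<epsilon> n * stride_blocks \<epsilon> n)) \<le> 10 * real n"
proof -
  let ?g = "real (num_blocks \<epsilon> n)"
  have g: "0 < ?g" using num_blocks_pos by simp
  have "?g * ?g * real (stride_blocks \<epsilon> n) \<le> ?g * ?g * (real n / (?g * ?g) + 1)"
    using stride_blocks_le g by (intro mult_left_mono) auto
  also have "\<dots> = real n + ?g * ?g" using g by (simp add: field_simps)
  also have "?g * ?g \<le> 9 * real n"
    using num_machines_le[OF assms(1,3)] powr_le_self[OF assms(1), of "2 * (1 - \<epsilon>)"] assms by simp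
  finally show ?thesis by (simp add: mult.assoc)
qed

lemma word_bound_grid:
  assumes \<epsilon>: "0 \<le> \<epsilon>" and inp: "three_sum_input n A B C"
  shows "grid n (num_blocks \<epsilon> n) (stride_blocks \<epsilon> n) (word_bound 10 n A B C) (\<lambda>l i. ([A, B, C] ! l) ! i)"
proof
  let ?g = "num_blocks \<epsilon> n" and ?w = "stride_blocks \<epsilon> n"
  define u where "u = Max (insert 0 (abs ` (set A \<union> set B \<union> set C)))"
  define b where "b = int n + u + 2"
  have u: "0 \<le> u" unfolding u_def by (intro Max_ge) auto
  then have b: "2 \<le> b" "int n + 1 \<le> b" "u \<le> b" unfolding b_def by auto
  have W: "word_bound 10 n A B C = b ^ 10" unfolding word_bound_def b_def u_def ..
  have pow: "b ^ k \<le> b ^ 10" if "k \<le> 10" for k using b(1) that by (intro power_increasing) auto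
  have g: "int ?g \<le> b" using num_blocks_le[OF \<epsilon>, of n] b(2) by linarith
  have "?w \<le> n + 1" unfolding stride_blocks_def by simp
  then have w: "int ?w \<le> b" using b(2) by linarith
  have "int ?g * int ?w \<le> b * b" using g w b(1) by (intro mult_mono) auto
  moreover have "0 \<le> int ?g * int ?w" by simp
  moreover have "int (72 * (?g * ?w)) = 72 * (int ?g * int ?w)" by simp
  \<comment> \<open>Rounding 72 up to a power of 2 lets \<open>2 \<le> b\<close> turn the constant
    into \<open>b ^ 7\<close>. This is the most demanding of the size conditions, and
    \<open>b ^ 9\<close> fits under the exponent 10.\<close>
  ultimately have "int (72 * (?g * ?w)) \<le> 128 * (b * b)" by linarith
  also have "128 = (2::int) ^ 7" by simp
  also have "2 ^ 7 * (b * b) \<le> b ^ 7 * (b * b)" using b(1) by (intro mult_right_mono power_mono) auto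
  also have "\<dots> = b ^ 9" by (simp add: eval_nat_numeral)
  finally show "int (72 * (?g * ?w)) \<le> word_bound 10 n A B C" using pow[of 9] unfolding W by simp
  have "int (?g * ?g) \<le> b * b" using mult_mono[OF g g] b(1) by simp
  then show "int (?g * ?g) \<le> word_bound 10 n A B C"
    using pow[of 2] unfolding W by (simp add: power2_eq_square)
  show "int n \<le> word_bound 10 n A B C" using pow[of 1] b(2) unfolding W by simp
  show "3 * \<bar>([A, B, C] ! l) ! i\<bar> + 2 \<le> word_bound 10 n A B C" if "l < 3" "i < n" for l i
  proof -
    have "([A, B, C] ! l) ! i \<in> set A \<union> set B \<union> set C"
      using that inp unfolding three_sum_input_def
      by (auto simp: numeral_3_eq_3 less_Suc_eq)
    then have "\<bar>([A, B, C] ! l) ! i\<bar> \<le> u" unfolding u_def by (intro Max_ge) auto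
    moreover have "3 * v + 2 \<le> 4 * b" if "v \<le> u" for v
      using that u unfolding b_def by simp
    ultimately have "3 * \<bar>([A, B, C] ! l) ! i\<bar> + 2 \<le> 4 * b" by blast
    also have "\<dots> \<le> (b * b) * b" using b(1) mult_mono[OF b(1) b(1)] by (intro mult_right_mono) auto
    also have "\<dots> \<le> b ^ 10" using pow[of 3] by (simp add: eval_nat_numeral)
    finally show ?thesis unfolding W .
  qed
  show "([A, B, C] ! l) ! i < ([A, B, C] ! l) ! i'" if "l < 3" "i < i'" "i' < n" for l i i'
    using that inp unfolding three_sum_input_def
    by (auto simp: numeral_3_eq_3 less_Suc_eq sorted_wrt_nth_less)
qed (simp_all add: num_blocks_pos stride_blocks_def)

lemma three_sum_iff_nth:
  assumes "three_sum_input n A B C"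
  shows "three_sum A B C \<longleftrightarrow> (\<exists>a<n. \<exists>b<n. \<exists>c<n. A ! a + B ! b = C ! c)"
  using assms unfolding three_sum_input_def three_sum_def Bex_def in_set_conv_nth by metis

lemma algorithm_correct:
  assumes "0 \<le> \<epsilon>"
  defines "g \<equiv> num_blocks \<epsilon>" and "w \<equiv> stride_blocks \<epsilon>"
  shows "solves_three_sum [scatter, match_blocks] search (\<lambda>n. g n * g n) (\<lambda>n. 72 * (g n * w n))
    (\<lambda>n. 275000 * (g n * (g n * w n))\<^sup>2)"
  unfolding solves_three_sum_def
proof (intro conjI, goal_cases)
  case 1
  show ?case by (simp add: g_def num_blocks_pos)
next
  case 2
  show ?case
  proof (rule exI[of _ 10], intro allI impI)
  fix n A B C p
  assume inp: "three_sum_input n A B C" and pl: "even_placement n (g n * g n) p"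
  interpret grid n "g n" "w n" "word_bound 10 n A B C" "\<lambda>l i. ([A, B, C] ! l) ! i"
    unfolding g_def w_def by (rule word_bound_grid[OF assms(1) inp])
  have "card {(l, i). l < 3 \<and> i < n \<and> p l i = k} \<le> 3 * w n" if "k < g n * g n" for k
  proof -
    have M: "0 < real (g n * g n)" using g_pos by simp
    \<comment> \<open>By \<open>size_less\<close> an even share of the \<open>3 * n\<close> numbers
      is at most \<open>3 * w\<close>, and this bound is an integer, so the ceiling does not exceed
      it.\<close>
    have "real (3 * n) \<le> real (3 * w n) * real (g n * g n)"
      using size_less by (simp only: of_nat_mult[symmetric] of_nat_le_iff)
    then have "real (3 * n) / real (g n * g n) \<le> real (3 * w n)"
      unfolding pos_divide_le_eq[OF M] .
    then have "\<lceil>real (3 * n) / real (g n * g n)\<rceil> \<le> int (3 * w n)"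
      unfolding ceiling_le_iff by simp
    moreover have "int (card {(l, i). l < 3 \<and> i < n \<and> p l i = k}) \<le> \<lceil>real (3 * n) / real (g n * g n)\<rceil>"
      using pl that unfolding even_placement_def by blast
    ultimately show ?thesis by linarith
  qed
  moreover have "p l i < g n * g n" if "l < 3" "i < n" for l i
    using pl that unfolding even_placement_def by blast
  ultimately show "\<exists>t\<le>275000 * (g n * (g n * w n))\<^sup>2.
      mr_run (word_bound 10 n A B C) n (g n * g n) (72 * (g n * w n)) [scatter, match_blocks] search
        (initial_inbox n A B C p) t (three_sum A B C)"
    unfolding three_sum_iff_nth[OF inp]
    using run_exists[of p "initial_inbox n A B C p"] initial_inbox_eq[of n A B C p] by simp
  qed
qed

theorem theorem3p1:
  fixes \<epsilon> :: real
  assumes "1 / 2 \<le> \<epsilon>" and "\<epsilon> \<le> 1"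
  shows "\<exists>(cs :: com list) (fin :: com) (M :: nat \<Rightarrow> nat) (S :: nat \<Rightarrow> nat) (T :: nat \<Rightarrow> nat).
           length cs = 2 \<and>
           solves_three_sum cs fin M S T \<and>
           (\<lambda>n. real (M n)) \<in> O(\<lambda>n. real n powr (2 * (1 - \<epsilon>))) \<and>
           (\<lambda>n. real (S n)) \<in> O(\<lambda>n. real n powr \<epsilon>) \<and>
           (\<lambda>n. real (T n)) \<in> O(\<lambda>n. real n ^ 2)"
proof -
  let ?g = "num_blocks \<epsilon>" and ?w = "stride_blocks \<epsilon>"
  have ev: "\<forall>\<^sub>F n in at_top. 0 < (n::nat)" by (rule eventually_gt_at_top)
  have "solves_three_sum [scatter, match_blocks] search (\<lambda>n. ?g n * ?g n) (\<lambda>n. 72 * (?g n * ?w n))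
      (\<lambda>n. 275000 * (?g n * (?g n * ?w n))\<^sup>2)"
    using assms by (intro algorithm_correct) simp
  moreover have "(\<lambda>n. real (?g n * ?g n)) \<in> O(\<lambda>n. real n powr (2 * (1 - \<epsilon>)))"
    using ev by (intro bigoI[where c = 9], elim eventually_mono)
      (use num_machines_le assms in auto)
  moreover have "(\<lambda>n. real (72 * (?g n * ?w n))) \<in> O(\<lambda>n. real n powr \<epsilon>)"
  proof (rule bigoI[where c = 288], use ev in \<open>elim eventually_mono\<close>)
    fix n :: nat
    assume "0 < n"
    then show "norm (real (72 * (?g n * ?w n))) \<le> 288 * norm (real n powr \<epsilon>)"
      using block_size_le[of n \<epsilon>] assms by simp
  qed
  \<comment> \<open>The machine-independent constant is 275000 times the square of the 10 in
    \<open>total_work_le\<close>.\<close>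
  moreover have "(\<lambda>n. real (275000 * (?g n * (?g n * ?w n))\<^sup>2)) \<in> O(\<lambda>n. real n ^ 2)"
  proof (rule bigoI[where c = 27500000], use ev in \<open>elim eventually_mono\<close>)
    fix n :: nat
    assume "0 < n"
    then have "(real (?g n * (?g n * ?w n)))\<^sup>2 \<le> (10 * real n)\<^sup>2"
      using total_work_le[of n \<epsilon>] assms by (intro power_mono) auto
    then show "norm (real (275000 * (?g n * (?g n * ?w n))\<^sup>2)) \<le> 27500000 * norm (real n ^ 2)"
      by (simp add: power_mult_distrib mult_ac)
  qed
  ultimately show ?thesis
    by (intro exI[of _ "[scatter, match_blocks]"] exI[of _ search]
        exI[of _ "\<lambda>n. ?g n * ?g n"] exI[of _ "\<lambda>n. 72 * (?g n * ?w n)"]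
        exI[of _ "\<lambda>n. 275000 * (?g n * (?g n * ?w n))\<^sup>2"] conjI) (assumption | simp)+
qed

end
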